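(* For every integer $k\ge 1$, the $(3k+4)$-dimensional Weisfeiler-Leman algorithm identifies every graph of rank width at most $k$; that is, if $G$ has rank width at most $k$ and $H$ is any graph with $H\not\cong G$, then the $(3k+4)$-dimensional Weisfeiler-Leman algorithm distinguishes $G$ and $H$.
   Context: All graphs are finite, simple and undirected; graphs may carry a vertex colouring, and isomorphisms must preserve vertex colours (an uncoloured graph is one where all vertices have the same colour). For a graph $G$ and $X\subseteq V(G)$ let $\overline X=V(G)\setminus X$ and let $\rho_G(X)$ be the rank over $\mathbb F_2$ of the $X\times\overline X$ matrix $M$ with $M_{x,y}=1$ iff $xy\in E(G)$. A rank decomposition of $G$ is a pair $(T,\gamma)$ where $T$ is a rooted binary tree and $\gamma:V(T)\to 2^{V(G)}$ satisfies: $\gamma(r)=V(G)$ for the root $r$; for each internal node $t$ with children $s_1,s_2$, $\gamma(t)$ is the disjoint union of $\gamma(s_1)$ and $\gamma(s_2)$; and $|\gamma(t)|=1$ for every leaf $t$. Its width is $\max_{t}\rho_G(\gamma(t))$, and the rank width of $G$ is the minimum width of a rank decomposition of $G$. The $\ell$-dimensional Weisfeiler-Leman algorithm ($\ell\ge2$): for a vertex-coloured graph $G$, the initial colour $\chi_0(v_1,\dots,v_\ell)$ of an $\ell$-tuple is its atomic type (the colours of the $v_i$, which pairs are equal, which pairs are adjacent); iteratively $\chi_{i+1}(\bar v)=(\chi_i(\bar v),\{\!\{(\chi_i(\bar v[w/1]),\dots,\chi_i(\bar v[w/\ell]))\mid w\in V(G)\}\!\})$ where $\bar v[w/j]$ replaces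 the $j$-th entry of $\bar v$ by $w$. The algorithm distinguishes $G$ and $H$ if for some $i$ and some colour $c$ the number of $\ell$-tuples of $G$ of colour $c$ under $\chi_i$ differs from the corresponding number for $H$. It identifies $G$ if it distinguishes $G$ from every graph not isomorphic to $G$. *)

theory Defs
  imports
    "Graph_Theory.Pair_Digraph"
    "HOL-Library.Multiset"
    "HOL-Library.Z2"
    "HOL-Library.Function_Algebras"
begin

text \<open>
  A finite simple undirected graph is a \<open>G :: 'a pair_pre_digraph\<close> with \<open>pair_graph G\<close>: finite
  vertex set, and a symmetric loop-free set of pairs of vertices as adjacency relation. A vertex
  colouring is a separate function \<open>c :: 'a \<Rightarrow> 'c\<close>, of which only the values on \<open>pverts G\<close> are ever
  used; uncoloured graphs are those with constant \<open>c\<close>.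
\<close>

definition coloured_isomorphic ::
  "'a pair_pre_digraph \<Rightarrow> ('a \<Rightarrow> 'c) \<Rightarrow> 'b pair_pre_digraph \<Rightarrow> ('b \<Rightarrow> 'c) \<Rightarrow> bool" where
  "coloured_isomorphic G c H d \<longleftrightarrow>
     (\<exists>f. bij_betw f (pverts G) (pverts H) \<and>
          (\<forall>u\<in>pverts G. \<forall>v\<in>pverts G. (u, v) \<in> parcs G \<longleftrightarrow> (f u, f v) \<in> parcs H) \<and>
          (\<forall>v\<in>pverts G. d (f v) = c v))"


section \<open>Rank width\<close>

text \<open>
  The functions \<open>'a \<Rightarrow> bit\<close> form a vector space over the two-element field \<open>bit\<close>.
\<close>

definition bit_scale :: "bit \<Rightarrow> ('a \<Rightarrow> bit) \<Rightarrow> 'a \<Rightarrow> bit" where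
  "bit_scale a f = (\<lambda>y. a * f y)"

lemma vector_space_bit_scale: "vector_space bit_scale"
  by unfold_locales (auto simp: bit_scale_def fun_eq_iff algebra_simps)

text \<open>
  Row \<open>x\<close> of the matrix with rows \<open>X\<close> and columns \<open>pverts G - X\<close>, padded with zeros outside the
  column set so that it lives in \<open>'a \<Rightarrow> bit\<close>. As for the matrix rank of HOL-Analysis, the rank is the
  dimension of (the span of) the set of rows.
\<close>

definition cut_row :: "'a pair_pre_digraph \<Rightarrow> 'a set \<Rightarrow> 'a \<Rightarrow> ('a \<Rightarrow> bit)" where
  "cut_row G X x = (\<lambda>y. if y \<in> pverts G - X \<and> (x, y) \<in> parcs G then 1 else 0)"

definition cut_rank :: "'a pair_pre_digraph \<Rightarrow> 'a set \<Rightarrow> nat" where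
  "cut_rank G X = vector_space.dim bit_scale (cut_row G X ` X)"

text \<open>
  A rooted binary tree \<open>T\<close> together with \<open>\<gamma>\<close> is encoded as one tree whose nodes \<open>t\<close>, inner nodes and
  leaves alike, carry \<open>\<gamma>(t)\<close> as label. \<open>labels T\<close> is the set of labels of all nodes of \<open>T\<close>.
\<close>

datatype (labels: 'n) bintree =
    Leaf (root_label: 'n)
  | Node (root_label: 'n) "'n bintree" "'n bintree"

primrec decomposes :: "'a set bintree \<Rightarrow> bool" where
  "decomposes (Leaf X) \<longleftrightarrow> card X = 1"
| "decomposes (Node X s1 s2) \<longleftrightarrow>
     X = root_label s1 \<union> root_label s2 \<and> root_label s1 \<inter> root_label s2 = {} \<and>
     decomposes s1 \<and> decomposes s2"

definition rank_decomposition :: "'a pair_pre_digraph \<Rightarrow> 'a set bintree \<Rightarrow> bool" where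
  "rank_decomposition G T \<longleftrightarrow> root_label T = pverts G \<and> decomposes T"

definition decomposition_width :: "'a pair_pre_digraph \<Rightarrow> 'a set bintree \<Rightarrow> nat" where
  "decomposition_width G T = Max (cut_rank G ` labels T)"

text \<open>
  The infimum is a minimum whenever \<open>G\<close> has a vertex. The graph without vertices has no rank
  decomposition; since \<open>Inf {} = 0\<close> on \<open>nat\<close>, its rank width is \<open>0\<close>.
\<close>

definition rank_width :: "'a pair_pre_digraph \<Rightarrow> nat" where
  "rank_width G = Inf (decomposition_width G ` {T. rank_decomposition G T})"


section \<open>The Weisfeiler-Leman algorithm\<close>

text \<open>
  Colours are formal terms, so colours computed in different graphs can be compared. An atomic type
  consists of the list of vertex colours and of the index pairs of equal and of adjacent entries.
\<close>

datatype 'c wl_colour =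
    Atomic "'c list" "(nat \<times> nat) set" "(nat \<times> nat) set"
  | Refined "'c wl_colour" "'c wl_colour list multiset"

definition atomic_type :: "'a pair_pre_digraph \<Rightarrow> ('a \<Rightarrow> 'c) \<Rightarrow> 'a list \<Rightarrow> 'c wl_colour" where
  "atomic_type G c v =
     Atomic (map c v)
       {(i, j). i < length v \<and> j < length v \<and> v ! i = v ! j}
       {(i, j). i < length v \<and> j < length v \<and> (v ! i, v ! j) \<in> parcs G}"

primrec wl :: "'a pair_pre_digraph \<Rightarrow> ('a \<Rightarrow> 'c) \<Rightarrow> nat \<Rightarrow> 'a list \<Rightarrow> 'c wl_colour" where
  "wl G c 0 = atomic_type G c"
| "wl G c (Suc i) = (\<lambda>v.
     Refined (wl G c i v)
       (image_mset (\<lambda>w. map (\<lambda>j. wl G c i (v[j := w])) [0..<length v]) (mset_set (pverts G))))"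

definition wl_count ::
  "nat \<Rightarrow> 'a pair_pre_digraph \<Rightarrow> ('a \<Rightarrow> 'c) \<Rightarrow> nat \<Rightarrow> 'c wl_colour \<Rightarrow> nat" where
  "wl_count l G c i q = card {v. length v = l \<and> set v \<subseteq> pverts G \<and> wl G c i v = q}"

definition wl_distinguishes ::
  "nat \<Rightarrow> 'a pair_pre_digraph \<Rightarrow> ('a \<Rightarrow> 'c) \<Rightarrow> 'b pair_pre_digraph \<Rightarrow> ('b \<Rightarrow> 'c) \<Rightarrow> bool" where
  "wl_distinguishes l G c H d \<longleftrightarrow> (\<exists>i q. wl_count l G c i q \<noteq> wl_count l H d i q)"

text \<open>
  HOL cannot quantify over the vertex type \<open>'b\<close> of \<open>H\<close> inside a formula, so that type is a
  parameter; a theorem with \<open>'b\<close> left as a type variable speaks about all graphs \<open>H\<close>.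
\<close>

definition wl_identifies :: "'b itself \<Rightarrow> nat \<Rightarrow> 'a pair_pre_digraph \<Rightarrow> ('a \<Rightarrow> 'c) \<Rightarrow> bool" where
  "wl_identifies _ l G c \<longleftrightarrow>
     (\<forall>(H :: 'b pair_pre_digraph) d. pair_graph H \<longrightarrow> \<not> coloured_isomorphic G c H d \<longrightarrow>
        wl_distinguishes l G c H d)"

end

theory Submission
  imports Defs
begin

text \<open>
  If the two graphs are not distinguished, there are equivalent tuples in \<open>G\<close> and \<open>H\<close>, and any entry
  can be exchanged along a bijection of the vertices that keeps the tuples equivalent. For a node
  \<open>X\<close> of the rank decomposition let the tuple contain a row basis \<open>A\<close> of the cut matrix of \<open>X\<close> and a
  set \<open>B\<close> of columns separating its row space. The types of the vertices, that is, their adjacency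
  to \<open>A \<union> B\<close> together with their degrees into the classes of this adjacency, determine the
  adjacency across the cut, so that flipping the edges between some pairs of types disconnects \<open>X\<close>
  from its complement. By induction along the decomposition, the component of the flipped graph of
  a vertex of \<open>X\<close> is isomorphic to the component of the corresponding vertex of \<open>H\<close>. For the
  induction step, bases of both children are added to the tuple; together with \<open>B\<close> these are at most
  \<open>3k\<close> vertices, and they contain split pairs of the children. The components for the children
  partition a set containing the component in question, and counting the isomorphism types of the
  components allows us to glue isomorphisms between them.
\<close>

text \<open>Degrees enter the types because a class of vertices with equal adjacency to
  \<open>A \<union> B\<close> may meet both sides of the cut; flipping by such classes alone need
  not cut off \<open>X\<close>. No decomposition of \<open>H\<close> is available. Cuts, bases and
  flips are therefore constructed in \<open>G\<close> only; a flip is a relation on types, so the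
  same one applies to \<open>H\<close>, and facts about \<open>H\<close> are pulled back to
  \<open>G\<close> along the exchange bijections. Such a bijection \<open>h\<close> compares single
  vertices with the tuple. It is not an isomorphism and may scatter a component over several
  components, which is why components have to be matched by counting. The isomorphisms must preserve
  types as well: adjacency between different components of a flipped graph is read off from the
  types of the end points. The bound \<open>3 * k\<close> comes from choosing the children's split
  pairs with \<open>A \<subseteq> A1 \<union> A2\<close>,
  \<open>B1 \<subseteq> B \<union> A2\<close> and \<open>B2 \<subseteq> B \<union> A1\<close>, so
  that \<open>A1 \<union> A2 \<union> B\<close> contains all of them. Outside these entries,
  following a path uses positions for its start, its end and a moving intermediate vertex.\<close>

lemma bij_betw_of_image_mset_eq:
  assumes "finite A" "finite B"
    and "image_mset f (mset_set A) = image_mset g (mset_set B)"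
  shows "\<exists>h. bij_betw h A B \<and> (\<forall>x\<in>A. g (h x) = f x)"
  using assms
proof (induction A arbitrary: B rule: finite_induct)
  case empty
  then have "B = {}"
    by (metis finite_set_mset_mset_set image_mset_is_empty_iff mset_set.empty set_mset_empty)
  then show ?case by (auto simp: bij_betw_def)
next
  case (insert x A)
  have eq: "image_mset g (mset_set B) = add_mset (f x) (image_mset f (mset_set A))"
    using insert by simp
  have "f x \<in># image_mset g (mset_set B)"
    unfolding eq by simp
  then obtain y where y: "y \<in> B" "g y = f x"
    using insert.prems(1) by auto
  have "mset_set B = add_mset y (mset_set (B - {y}))"
    using y insert.prems(1) by (simp add: mset_set.remove)
  then have "image_mset f (mset_set A) = image_mset g (mset_set (B - {y}))"
    using eq y by simp
  then obtain h where h: "bij_betw h A (B - {y})" "\<forall>z\<in>A. g (h z) = f z"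
    using insert.IH[of "B - {y}"] insert.prems by auto
  have "bij_betw (h(x := y)) (insert x A) (insert y (B - {y}))"
    using h(1) insert.hyps(2) unfolding bij_betw_def inj_on_def by auto
  moreover have "insert y (B - {y}) = B" using y by auto
  ultimately have "bij_betw (h(x := y)) (insert x A) B" by (simp only:)
  moreover have "\<forall>z\<in>insert x A. g ((h(x := y)) z) = f z" using h(2) y insert.hyps(2) by auto
  ultimately show ?case by blast
qed

lemma pair_graph_sym:
  assumes "pair_graph G"
  shows "(x, y) \<in> parcs G \<longleftrightarrow> (y, x) \<in> parcs G"
proof -
  interpret pair_graph G by fact
  show ?thesis using arcs_symmetric by blast
qed

lemma pair_graph_finite: "pair_graph G \<Longrightarrow> finite (pverts G)"
  by (simp add: pair_graph_def pair_digraph_def pair_fin_digraph_def pair_fin_digraph_axioms_def)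

section \<open>Weisfeiler-Leman equivalence of tuples\<close>

text \<open>Quantifying over all rounds plays the role of comparing stable colours.\<close>

definition wl_equiv ::
  "nat \<Rightarrow> 'a pair_pre_digraph \<Rightarrow> ('a \<Rightarrow> 'c) \<Rightarrow> 'b pair_pre_digraph \<Rightarrow> ('b \<Rightarrow> 'c) \<Rightarrow> 'a list \<Rightarrow> 'b list \<Rightarrow> bool" where
  "wl_equiv l G c H d v w \<longleftrightarrow> length v = l \<and> length w = l \<and> set v \<subseteq> pverts G \<and> set w \<subseteq> pverts H \<and>
     (\<forall>i. wl G c i v = wl H d i w)"

lemma wl_equiv_sym: "wl_equiv l G c H d v w \<Longrightarrow> wl_equiv l H d G c w v"
  by (auto simp: wl_equiv_def)

lemma wl_equiv_nth:
  assumes "wl_equiv l G c H d v w" "i < l"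
  shows "v ! i \<in> pverts G" "w ! i \<in> pverts H" "d (w ! i) = c (v ! i)"
proof -
  show "v ! i \<in> pverts G" "w ! i \<in> pverts H"
    using assms unfolding wl_equiv_def by (metis nth_mem subsetD)+
  have "wl G c 0 v = wl H d 0 w" using assms by (simp only: wl_equiv_def)
  then have "map c v ! i = map d w ! i" by (simp add: atomic_type_def)
  then show "d (w ! i) = c (v ! i)" using assms by (simp add: wl_equiv_def)
qed

lemma wl_equiv_nth2:
  assumes "wl_equiv l G c H d v w" "i < l" "j < l"
  shows "v ! i = v ! j \<longleftrightarrow> w ! i = w ! j"
    and "(v ! i, v ! j) \<in> parcs G \<longleftrightarrow> (w ! i, w ! j) \<in> parcs H"
proof -
  have "wl G c 0 v = wl H d 0 w" and len: "length v = l" "length w = l"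
    using assms by (simp_all only: wl_equiv_def)
  then have eq: "{(i, j). i < l \<and> j < l \<and> v ! i = v ! j} = {(i, j). i < l \<and> j < l \<and> w ! i = w ! j}"
    and adj: "{(i, j). i < l \<and> j < l \<and> (v ! i, v ! j) \<in> parcs G} =
      {(i, j). i < l \<and> j < l \<and> (w ! i, w ! j) \<in> parcs H}"
    by (simp_all add: atomic_type_def)
  show "v ! i = v ! j \<longleftrightarrow> w ! i = w ! j"
    using arg_cong[OF eq, of "\<lambda>S. (i, j) \<in> S"] assms(2,3) by simp
  show "(v ! i, v ! j) \<in> parcs G \<longleftrightarrow> (w ! i, w ! j) \<in> parcs H"
    using arg_cong[OF adj, of "\<lambda>S. (i, j) \<in> S"] assms(2,3) by simp
qed

lemma wl_equal_downward:
  assumes "wl G c j v = wl H d j w" "i \<le> j"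
  shows "wl G c i v = wl H d i w"
  using assms(2,1) by (induction rule: dec_induct) auto

text \<open>A compactness argument: the witnesses of the single rounds come from a finite set, so
  one of them recurs in arbitrarily late rounds, and it is then valid in all earlier rounds
  too.\<close>

lemma finite_choice_for_all_rounds:
  fixes P :: "nat \<Rightarrow> 'x \<Rightarrow> bool"
  assumes "finite S" "\<And>i. \<exists>x\<in>S. P i x" "\<And>i j x. P j x \<Longrightarrow> i \<le> j \<Longrightarrow> P i x"
  shows "\<exists>x\<in>S. \<forall>i. P i x"
proof -
  obtain x where x: "x i \<in> S" "P i (x i)" for i using assms(2) by metis
  have "finite (range x)" using x(1) assms(1) by (meson finite_subset image_subsetI)
  then obtain y where y: "infinite {i. x i = x y}"
    using pigeonhole_infinite[of "UNIV :: nat set" x] by auto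
  have "P i (x y)" for i
  proof -
    obtain j where "x j = x y" "j > i"
      using y unfolding infinite_nat_iff_unbounded by auto
    then show ?thesis using x(2)[of j] assms(3)[of j _ i] by simp
  qed
  then show ?thesis using x(1) by blast
qed

text \<open>This is the answer in the bijective pebble game. Equal colours in round
  \<open>Suc i\<close> match the multisets of colour vectors of round \<open>i\<close>; a vector
  covers all positions, so one \<open>h\<close> serves every \<open>j\<close>, and finite choice
  makes one \<open>h\<close> serve every round.\<close>

lemma wl_equiv_bij:
  assumes fin: "finite (pverts G)" "finite (pverts H)" and vw: "wl_equiv l G c H d v w"
  obtains h where "bij_betw h (pverts G) (pverts H)"
    and "\<And>x j. x \<in> pverts G \<Longrightarrow> j < l \<Longrightarrow> wl_equiv l G c H d (v[j := x]) (w[j := h x])"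
proof -
  let ?V = "pverts G" and ?W = "pverts H"
  have len: "length v = l" "length w = l" and sub: "set v \<subseteq> ?V" "set w \<subseteq> ?W"
    using vw by (simp_all add: wl_equiv_def)
  define P where "P i h \<longleftrightarrow> bij_betw h ?V ?W \<and>
    (\<forall>x\<in>?V. \<forall>j<l. wl G c i (v[j := x]) = wl H d i (w[j := h x]))" for i h
  \<comment> \<open>Extensional functions form a finite set of candidates, as the choice over all
    rounds requires.\<close>
  have ex: "\<exists>h\<in>?V \<rightarrow>\<^sub>E ?W. P i h" for i
  proof -
    let ?f = "\<lambda>x. map (\<lambda>j. wl G c i (v[j := x])) [0..<l]"
    let ?g = "\<lambda>x. map (\<lambda>j. wl H d i (w[j := x])) [0..<l]"
    have "wl G c (Suc i) v = wl H d (Suc i) w" using vw unfolding wl_equiv_def by blast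
    then have "image_mset ?f (mset_set ?V) = image_mset ?g (mset_set ?W)"
      using len by simp
    then obtain h where h: "bij_betw h ?V ?W" "\<forall>x\<in>?V. ?g (h x) = ?f x"
      using bij_betw_of_image_mset_eq[OF fin, of ?f ?g] by auto
    have "wl G c i (v[j := x]) = wl H d i (w[j := h x])" if "x \<in> ?V" "j < l" for x j
      using arg_cong[OF h(2)[rule_format, OF that(1)], of "\<lambda>xs. xs ! j"] that(2) by simp
    then have "P i (restrict h ?V)"
      using h(1) by (auto simp: P_def bij_betw_def inj_on_def)
    moreover have "restrict h ?V \<in> ?V \<rightarrow>\<^sub>E ?W"
      using h(1) by (auto simp: bij_betw_def)
    ultimately show ?thesis by blast
  qed
  obtain h where h: "\<And>i. P i h"
    using finite_choice_for_all_rounds[of "?V \<rightarrow>\<^sub>E ?W" P] ex fin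
    by (metis (no_types, lifting) P_def finite_PiE wl_equal_downward)
  have "wl_equiv l G c H d (v[j := x]) (w[j := h x])" if x: "x \<in> ?V" "j < l" for x j
  proof -
    have "h x \<in> ?W" using h[of 0] x(1) by (auto simp: P_def bij_betw_def)
    then have "set (v[j := x]) \<subseteq> ?V" "set (w[j := h x]) \<subseteq> ?W"
      using sub x(1) set_update_subset_insert by fast+
    then show ?thesis using h x len by (simp add: wl_equiv_def P_def)
  qed
  then show ?thesis using that h unfolding P_def by blast
qed

lemma wl_equiv_of_not_distinguished:
  assumes fin: "finite (pverts H)" and ndist: "\<not> wl_distinguishes l G c H d"
    and v: "length v = l" "set v \<subseteq> pverts G" and finG: "finite (pverts G)"
  obtains w where "wl_equiv l G c H d v w"
proof -
  let ?S = "{w. set w \<subseteq> pverts H \<and> length w = l}"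
  have "\<exists>w\<in>?S. wl G c i v = wl H d i w" for i
  proof -
    let ?A = "{x. length x = l \<and> set x \<subseteq> pverts G \<and> wl G c i x = wl G c i v}"
    have "finite ?A"
      by (rule finite_subset[OF _ finite_lists_length_eq[OF finG, of l]]) auto
    then have "card ?A \<noteq> 0" using v by (auto simp: card_eq_0_iff)
    then have "wl_count l H d i (wl G c i v) \<noteq> 0"
      using ndist by (metis wl_count_def wl_distinguishes_def)
    then have "{x. length x = l \<and> set x \<subseteq> pverts H \<and> wl H d i x = wl G c i v} \<noteq> {}"
      unfolding wl_count_def by (metis card.empty)
    then show ?thesis by auto
  qed
  then obtain w where "w \<in> ?S" "\<forall>i. wl G c i v = wl H d i w"
    using finite_choice_for_all_rounds[of ?S "\<lambda>i w. wl G c i v = wl H d i w"]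
      finite_lists_length_eq[OF fin, of l] wl_equal_downward by blast
  then show ?thesis using that[of w] v by (simp add: wl_equiv_def)
qed

lemma fresh_index:
  assumes "finite J" "card J < l"
  obtains m where "m < l" "m \<notin> J"
proof -
  have "\<not> {..<l} \<subseteq> J" using card_mono[OF assms(1), of "{..<l}"] assms(2) by auto
  then show ?thesis using that by auto
qed

lemma wl_equiv_add_entries:
  assumes fin: "finite (pverts G)" "finite (pverts H)" and uu: "wl_equiv l G c H d u u'"
    and W: "finite W" "W \<subseteq> pverts G" and K: "K \<subseteq> {..<l}" "card K + card W \<le> l"
  shows "\<exists>t t' J. wl_equiv l G c H d t t' \<and> (\<forall>j\<in>K. t ! j = u ! j \<and> t' ! j = u' ! j) \<and>
    J \<subseteq> {..<l} \<and> J \<inter> K = {} \<and> bij_betw ((!) t) J W"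
  using W K(2)
proof (induction W rule: finite_induct)
  case empty
  then show ?case using uu by (intro exI[of _ u] exI[of _ u'] exI[of _ "{}"]) (auto simp: bij_betw_def)
next
  case (insert x W)
  obtain t t' J where t: "wl_equiv l G c H d t t'" "\<forall>j\<in>K. t ! j = u ! j \<and> t' ! j = u' ! j"
    and J: "J \<subseteq> {..<l}" "J \<inter> K = {}" "bij_betw ((!) t) J W"
    using insert by auto
  have finKJ: "finite K" "finite J" using K(1) J(1) finite_subset by auto
  have "card (K \<union> J) < l"
    using insert card_Un_le[of K J] bij_betw_same_card[OF J(3)] by simp
  then obtain m where m: "m < l" "m \<notin> K \<union> J" using fresh_index[of "K \<union> J"] finKJ by blast
  obtain h where h: "wl_equiv l G c H d (t[m := x]) (t'[m := h x])"
    using wl_equiv_bij[OF fin t(1)] m(1) insert.prems by (metis insert_subset)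
  have len: "length t = l" using t(1) by (simp add: wl_equiv_def)
  have "bij_betw ((!) (t[m := x])) J W"
    using J(3) m(2) by (subst bij_betw_cong[of _ _ "(!) t"]) (metis UnI2 nth_list_update_neq)
  then have "bij_betw ((!) (t[m := x])) (insert m J) (insert x W)"
    using m insert.hyps(2) len notIn_Un_bij_betw[of m J "(!) (t[m := x])" W] by auto
  then show ?case
    using h t(2) m J
    by (intro exI[of _ "t[m := x]"] exI[of _ "t'[m := h x]"] exI[of _ "insert m J"] conjI ballI)
      (auto, (metis nth_list_update_neq)+)
qed

section \<open>Split pairs\<close>

interpretation bits: vector_space bit_scale
  by (rule vector_space_bit_scale)

lemma independent_if_independent_image:
  fixes f :: "('a \<Rightarrow> bit) \<Rightarrow> ('a \<Rightarrow> bit)"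
  assumes lin: "module_hom bit_scale bit_scale f"
    and ind: "bits.independent (f ` S)" and inj: "inj_on f S"
  shows "bits.independent S"
proof
  interpret f: module_hom bit_scale bit_scale f by fact
  assume "bits.dependent S"
  then obtain a where a: "a \<in> S" "a \<in> bits.span (S - {a})"
    unfolding bits.dependent_def by blast
  then have "f a \<in> bits.span (f ` (S - {a}))" using f.span_image by blast
  also have "f ` (S - {a}) = f ` S - {f a}" using inj a(1) by (auto simp: inj_on_def)
  finally show False using ind a(1) unfolding bits.dependent_def by blast
qed

lemma module_hom_restrict:
  "module_hom bit_scale bit_scale (\<lambda>(f :: 'a \<Rightarrow> bit) y. if y \<in> Y then f y else 0)"
  by unfold_locales (auto simp: bit_scale_def fun_eq_iff algebra_simps)

lemma subspace_eval:
  "bits.subspace {f :: 'a \<Rightarrow> bit. f y = 0}"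
  "bits.subspace {f :: 'a \<Rightarrow> bit. f y = f z}"
  by (auto simp: bits.subspace_def bit_scale_def)

text \<open>
  \<open>A\<close> indexes a basis of the row space of the cut matrix of \<open>X\<close>, and the columns in \<open>B\<close> suffice to
  tell the vectors of the row space apart. Taking \<open>B\<close> as a set of coordinates rather than as a basis
  of the column space avoids comparing row rank with column rank.
\<close>

definition split_pair :: "'a pair_pre_digraph \<Rightarrow> 'a set \<Rightarrow> 'a set \<Rightarrow> 'a set \<Rightarrow> bool" where
  "split_pair G X A B \<longleftrightarrow>
     A \<subseteq> X \<and> inj_on (cut_row G X) A \<and> bits.independent (cut_row G X ` A) \<and>
     cut_row G X ` X \<subseteq> bits.span (cut_row G X ` A) \<and> B \<subseteq> pverts G - X \<and>
     (\<forall>r \<in> bits.span (cut_row G X ` X). (\<forall>b\<in>B. r b = 0) \<longrightarrow> r = 0)"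

lemma split_pair_subsets:
  "split_pair G X A B \<Longrightarrow> A \<subseteq> X" "split_pair G X A B \<Longrightarrow> B \<subseteq> pverts G - X"
  by (auto simp: split_pair_def)

lemma split_pair_separates:
  assumes "split_pair G X A B" "r \<in> bits.span (cut_row G X ` X)" "\<And>b. b \<in> B \<Longrightarrow> r b = 0"
  shows "r = 0"
proof -
  have "\<forall>r \<in> bits.span (cut_row G X ` X). (\<forall>b\<in>B. r b = 0) \<longrightarrow> r = 0"
    using assms(1) unfolding split_pair_def by (elim conjE)
  then show ?thesis using assms(2,3) by auto
qed

text \<open>The difference of the two rows lies in the row space and vanishes on \<open>B\<close>,
  hence is zero.\<close>

lemma split_pair_row_eq:
  assumes sp: "split_pair G X A B" and "x \<in> X" "x' \<in> X"
    and eq: "\<And>b. b \<in> B \<Longrightarrow> (x, b) \<in> parcs G \<longleftrightarrow> (x', b) \<in> parcs G" and y: "y \<in> pverts G - X"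
  shows "(x, y) \<in> parcs G \<longleftrightarrow> (x', y) \<in> parcs G"
proof -
  let ?r = "cut_row G X x - cut_row G X x'"
  have "?r \<in> bits.span (cut_row G X ` X)"
    using assms by (intro bits.span_diff bits.span_base) auto
  moreover have "\<forall>b\<in>B. ?r b = 0" using eq by (auto simp: cut_row_def)
  ultimately have "?r = 0" using sp unfolding split_pair_def by blast
  then have "cut_row G X x y = cut_row G X x' y" by simp
  then show ?thesis using y by (auto simp: cut_row_def split: if_splits)
qed

text \<open>Having equal entries at \<open>y\<close> and \<open>y'\<close> is a linear condition, so
  it passes from the basis rows to every row.\<close>

lemma split_pair_column_eq:
  assumes sp: "split_pair G X A B" and y: "y \<in> pverts G - X" "y' \<in> pverts G - X"
    and eq: "\<And>a. a \<in> A \<Longrightarrow> (a, y) \<in> parcs G \<longleftrightarrow> (a, y') \<in> parcs G" and x: "x \<in> X"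
  shows "(x, y) \<in> parcs G \<longleftrightarrow> (x, y') \<in> parcs G"
proof -
  have "cut_row G X ` A \<subseteq> {f. f y = f y'}" using eq y by (auto simp: cut_row_def)
  then have "bits.span (cut_row G X ` A) \<subseteq> {f. f y = f y'}"
    by (intro bits.span_minimal subspace_eval)
  then have "cut_row G X x y = cut_row G X x y'" using sp x unfolding split_pair_def by blast
  then show ?thesis using y by (auto simp: cut_row_def split: if_splits)
qed

text \<open>The extension takes place among row vectors; one vertex is then chosen for each new
  vector, so that the number of vertices equals the rank even when several vertices have the same
  row.\<close>

lemma exists_row_basis:
  assumes "A0 \<subseteq> X" "inj_on (cut_row G X) A0" "bits.independent (cut_row G X ` A0)"
  obtains A where "A0 \<subseteq> A" "A \<subseteq> X" "inj_on (cut_row G X) A" "bits.independent (cut_row G X ` A)"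
    "cut_row G X ` X \<subseteq> bits.span (cut_row G X ` A)" "card A = cut_rank G X"
proof -
  let ?r = "cut_row G X"
  obtain \<B> where \<B>: "?r ` A0 \<subseteq> \<B>" "\<B> \<subseteq> ?r ` X" "bits.independent \<B>" "?r ` X \<subseteq> bits.span \<B>"
    using bits.maximal_independent_subset_extend[OF image_mono[OF assms(1)] assms(3)] by metis
  have "\<B> - ?r ` A0 \<subseteq> ?r ` X" using \<B>(2) by auto
  then obtain U where U: "U \<subseteq> X" "inj_on ?r U" "\<B> - ?r ` A0 = ?r ` U"
    unfolding subset_image_inj by blast
  have im: "?r ` (A0 \<union> U) = \<B>" using U(3) \<B>(1) by auto
  have inj: "inj_on ?r (A0 \<union> U)"
    using assms(2) U by (subst inj_on_Un) auto
  have "card (A0 \<union> U) = card \<B>" using inj im by (metis card_image)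
  also have "\<dots> = cut_rank G X"
    unfolding cut_rank_def using \<B> by (intro bits.basis_card_eq_dim)
  finally show ?thesis using that[of "A0 \<union> U"] im inj assms(1) U(1) \<B> by simp
qed

text \<open>
  A minimal separating set of coordinates has no more elements than the dimension: each coordinate
  \<open>b\<close> of it is the only one on which some vector of the space does not vanish.
\<close>

lemma exists_small_separator:
  fixes R :: "('a \<Rightarrow> bit) set"
  assumes R: "finite R" and D: "finite D" "\<forall>r \<in> bits.span R. (\<forall>b\<in>D. r b = 0) \<longrightarrow> r = 0"
  obtains B where "B \<subseteq> D" "\<forall>r \<in> bits.span R. (\<forall>b\<in>B. r b = 0) \<longrightarrow> r = 0" "card B \<le> bits.dim R"
proof -
  define sep where "sep B \<longleftrightarrow> (\<forall>r \<in> bits.span R. (\<forall>b\<in>B. r b = 0) \<longrightarrow> r = 0)" for B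
  have "D \<subseteq> D \<and> sep D" using D(2) by (simp add: sep_def)
  then obtain B where B: "B \<subseteq> D" "sep B" and least: "\<And>B'. B' \<subseteq> D \<and> sep B' \<Longrightarrow> card B \<le> card B'"
    using ex_has_least_nat[of "\<lambda>B. B \<subseteq> D \<and> sep B" D card] by metis
  have finB: "finite B" using B D(1) finite_subset by blast
  have "\<exists>r \<in> bits.span R. (\<forall>b'\<in>B - {b}. r b' = 0) \<and> r b \<noteq> 0" if b: "b \<in> B" for b
  proof -
    have "card (B - {b}) < card B" using b finB by (meson card_Diff1_less)
    then have "\<not> sep (B - {b})" using least[of "B - {b}"] B(1) by auto
    then obtain r where r: "r \<in> bits.span R" "\<forall>b'\<in>B - {b}. r b' = 0" "r \<noteq> 0"
      unfolding sep_def by auto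
    have "r b \<noteq> 0"
    proof
      assume "r b = 0"
      then have "\<forall>b'\<in>B. r b' = 0" using r(2) by auto
      then show False using B(2) r(1,3) unfolding sep_def by auto
    qed
    then show ?thesis using r by auto
  qed
  then have "\<forall>b\<in>B. \<exists>r. r \<in> bits.span R \<and> (\<forall>b'\<in>B - {b}. r b' = 0) \<and> r b \<noteq> 0" by blast
  then obtain w where w':
    "\<forall>b\<in>B. w b \<in> bits.span R \<and> (\<forall>b'\<in>B - {b}. w b b' = 0) \<and> w b b \<noteq> 0"
    using bchoice[of B "\<lambda>b r. r \<in> bits.span R \<and> (\<forall>b'\<in>B - {b}. r b' = 0) \<and> r b \<noteq> 0"] by blast
  have w: "\<And>b. b \<in> B \<Longrightarrow> w b \<in> bits.span R"
    "\<And>b b'. b \<in> B \<Longrightarrow> b' \<in> B \<Longrightarrow> b' \<noteq> b \<Longrightarrow> w b b' = 0" "\<And>b. b \<in> B \<Longrightarrow> w b b \<noteq> 0"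
    using w' by auto
  have inj: "inj_on w B"
  proof
    fix b b' assume "b \<in> B" "b' \<in> B" "w b = w b'"
    then show "b = b'" using w(2)[of b b'] w(3)[of b'] by auto
  qed
  have "bits.independent (w ` B)"
  proof
    assume "bits.dependent (w ` B)"
    then obtain b where b: "b \<in> B" "w b \<in> bits.span (w ` B - {w b})"
      unfolding bits.dependent_def by blast
    have "w ` B - {w b} \<subseteq> {f. f b = 0}" using w(2) b(1) by auto
    then have "bits.span (w ` B - {w b}) \<subseteq> {f. f b = 0}"
      by (intro bits.span_minimal subspace_eval)
    then show False using b w(3) by blast
  qed
  moreover obtain T where T: "T \<subseteq> R" "R \<subseteq> bits.span T" "card T = bits.dim R"
    by (rule bits.basis_exists)
  moreover have "w ` B \<subseteq> bits.span T"
    using w(1) T(2) bits.span_minimal[OF T(2) bits.subspace_span] by blast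
  moreover have "finite T" using R T(1) finite_subset by blast
  ultimately have "card (w ` B) \<le> bits.dim R"
    using bits.independent_span_bound[of T "w ` B"] by simp
  then show ?thesis using that[of B] B inj by (simp add: card_image sep_def)
qed

text \<open>
  Evaluating a row combination over \<open>X\<close> at \<open>y\<close> is a linear functional applied to the row of \<open>y\<close>, by
  symmetry of the adjacency matrix.
\<close>

lemma span_rows_eval:
  assumes sym: "sym (parcs G)"
    and XY: "X \<subseteq> pverts G" "Y \<subseteq> pverts G" "X \<inter> Y = {}"
    and r: "r \<in> bits.span (cut_row G X ` X)"
  shows "\<exists>\<Phi>. bits.subspace {s. \<Phi> s = (0 :: bit)} \<and> (\<forall>y\<in>Y. r y = \<Phi> (cut_row G Y y))"
proof -
  let ?P = "\<lambda>r. \<exists>\<Phi>. (\<forall>s t. \<Phi> (s + t) = \<Phi> s + \<Phi> t) \<and> (\<forall>a s. \<Phi> (bit_scale a s) = a * \<Phi> s) \<and>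
    (\<forall>y\<in>Y. r y = \<Phi> (cut_row G Y y))"
  have "?P r"
    using r
  proof (induction rule: bits.span_induct_alt)
    case base
    show ?case by (intro exI[of _ "\<lambda>_. 0"]) simp
  next
    case (step c v t)
    then obtain x where x: "x \<in> X" "v = cut_row G X x" by blast
    obtain \<Phi> where \<Phi>: "\<forall>s t. \<Phi> (s + t) = \<Phi> s + \<Phi> t" "\<forall>a s. \<Phi> (bit_scale a s) = a * \<Phi> s"
      "\<forall>y\<in>Y. t y = \<Phi> (cut_row G Y y)"
      using step(2) by (elim exE conjE) (rule that)
    have v: "v y = cut_row G Y y x" if "y \<in> Y" for y
      using that x XY by (auto simp: cut_row_def dest: symD[OF sym])
    show ?case
    proof (intro exI[of _ "\<lambda>s. c * s x + \<Phi> s"] conjI allI ballI)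
      show "c * (s + s') x + \<Phi> (s + s') = (c * s x + \<Phi> s) + (c * s' x + \<Phi> s')" for s s'
        by (simp only: \<Phi>(1) plus_fun_apply distrib_left ac_simps)
      show "c * bit_scale a s x + \<Phi> (bit_scale a s) = a * (c * s x + \<Phi> s)" for a s
        unfolding \<Phi>(2)[rule_format] by (simp only: bit_scale_def distrib_left ac_simps)
      show "(bit_scale c v + t) y = c * cut_row G Y y x + \<Phi> (cut_row G Y y)" if "y \<in> Y" for y
        using v \<Phi>(3) that by (simp only: plus_fun_apply bit_scale_def)
    qed
  qed
  then obtain \<Phi> where \<Phi>: "\<forall>s t. \<Phi> (s + t) = \<Phi> s + \<Phi> t" "\<forall>a s. \<Phi> (bit_scale a s) = a * \<Phi> s"
    "\<forall>y\<in>Y. r y = \<Phi> (cut_row G Y y)" by (elim exE conjE) (rule that)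
  have "\<Phi> 0 = 0" using \<Phi>(2)[rule_format, of 0 0] by (simp add: bit_scale_def zero_fun_def)
  then show ?thesis using \<Phi> by (intro exI[of _ \<Phi>]) (auto simp: bits.subspace_def)
qed

text \<open>This is why the columns of a child can be found in \<open>B\<close> and the sibling's
  basis. On \<open>X2\<close>, the value \<open>r y\<close> is a linear functional of the row of
  \<open>y\<close> in the sibling's cut, and it vanishes on the basis \<open>A2\<close>. Outside
  \<open>X\<close>, the restriction of \<open>r\<close> lies in the row space of the parent and
  vanishes on \<open>B\<close>. All other coordinates are padding.\<close>

lemma separator_of_child:
  assumes sym: "sym (parcs G)"
    and X: "X = X1 \<union> X2" "X1 \<inter> X2 = {}" "X \<subseteq> pverts G"
    and sp: "split_pair G X A B"
    and A2: "A2 \<subseteq> X2" "cut_row G X2 ` X2 \<subseteq> bits.span (cut_row G X2 ` A2)"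
    and r: "r \<in> bits.span (cut_row G X1 ` X1)" "\<forall>b\<in>B \<union> A2. r b = 0"
  shows "r = 0"
proof
  fix y
  show "r y = 0 y"
  proof (cases "y \<in> X2")
    case True
    have "X1 \<subseteq> pverts G" "X2 \<subseteq> pverts G" using X by auto
    from span_rows_eval[OF sym this X(2) r(1)]
    obtain \<Phi> where \<Phi>: "bits.subspace {s. \<Phi> s = (0 :: bit)}" "\<forall>y\<in>X2. r y = \<Phi> (cut_row G X2 y)"
      by (elim exE conjE) (rule that)
    have eval: "\<Phi> (cut_row G X2 y) = r y" if "y \<in> X2" for y using \<Phi>(2) that by simp
    then have "cut_row G X2 ` A2 \<subseteq> {s. \<Phi> s = 0}" using r(2) A2(1) by auto
    then have "bits.span (cut_row G X2 ` A2) \<subseteq> {s. \<Phi> s = 0}" by (rule bits.span_minimal[OF _ \<Phi>(1)])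
    then have "\<Phi> (cut_row G X2 y) = 0" using A2(2) True by blast
    then show ?thesis using eval True by simp
  next
    case False
    let ?Y = "pverts G - X"
    let ?f = "\<lambda>(f :: 'a \<Rightarrow> bit) y. if y \<in> ?Y then f y else 0"
    interpret f: module_hom bit_scale bit_scale ?f by (rule module_hom_restrict)
    have "?f r \<in> bits.span (?f ` cut_row G X1 ` X1)" using r(1) f.span_image by blast
    also have "?f ` cut_row G X1 ` X1 = cut_row G X ` X1"
      unfolding image_image by (intro image_cong refl) (auto simp: cut_row_def X(1))
    also have "bits.span (cut_row G X ` X1) \<subseteq> bits.span (cut_row G X ` X)"
      using X(1) by (intro bits.span_mono) auto
    finally have "?f r \<in> bits.span (cut_row G X ` X)" .
    then have f0: "?f r = 0"
    proof (rule split_pair_separates[OF sp])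
      show "?f r b = 0" if "b \<in> B" for b using r(2) that by simp
    qed
    have "cut_row G X1 ` X1 \<subseteq> {f. f y = 0}" if "y \<notin> ?Y"
      using that False X(1) by (auto simp: cut_row_def)
    then have "bits.span (cut_row G X1 ` X1) \<subseteq> {f. f y = 0}" if "y \<notin> ?Y"
      using that by (intro bits.span_minimal subspace_eval) auto
    then show ?thesis using fun_cong[OF f0, of y] r(1) by (cases "y \<in> ?Y") auto
  qed
qed

text \<open>Rows of the parent arise from rows of the child by the linear map that deletes columns.
  Independence lifts back along it, so the part of \<open>A\<close> in the child extends to a basis
  there.\<close>

lemma split_pair_basis_of_child:
  assumes X: "X1 \<subseteq> X" and sp: "split_pair G X A B"
  obtains A1 where "A \<inter> X1 \<subseteq> A1" "A1 \<subseteq> X1" "inj_on (cut_row G X1) A1"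
    "bits.independent (cut_row G X1 ` A1)"
    "cut_row G X1 ` X1 \<subseteq> bits.span (cut_row G X1 ` A1)" "card A1 = cut_rank G X1"
proof -
  let ?f = "\<lambda>(f :: 'a \<Rightarrow> bit) y. if y \<in> pverts G - X then f y else 0"
  have row: "cut_row G X x = ?f (cut_row G X1 x)" for x
    using X by (auto simp: cut_row_def fun_eq_iff)
  have "inj_on (cut_row G X) A" and indA: "bits.independent (cut_row G X ` A)"
    using sp[unfolded split_pair_def] by blast+
  then have inj: "inj_on (cut_row G X) (A \<inter> X1)" by (auto intro: inj_on_subset)
  have ind: "bits.independent (cut_row G X ` (A \<inter> X1))"
    by (rule bits.independent_mono[OF indA image_mono[OF Int_lower1]])
  have comp: "inj_on (?f \<circ> cut_row G X1) (A \<inter> X1)" using inj unfolding row comp_def .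
  note inj1 = inj_on_imageI2[OF comp] and inj2 = inj_on_imageI[OF comp]
  have "cut_row G X ` (A \<inter> X1) = ?f ` cut_row G X1 ` (A \<inter> X1)"
    unfolding row image_image ..
  then have "bits.independent (cut_row G X1 ` (A \<inter> X1))"
    using independent_if_independent_image[OF module_hom_restrict _ inj2] ind by simp
  then show ?thesis by (rule exists_row_basis[OF Int_lower2 inj1]) (rule that)
qed

text \<open>The inclusions are the point: everything needed for the parent and both children lies in
  \<open>A1 \<union> A2 \<union> B\<close>, three sets of size at most the width.\<close>

lemma split_pair_children:
  assumes sym: "sym (parcs G)" and fin: "finite (pverts G)"
    and X: "X = X1 \<union> X2" "X1 \<inter> X2 = {}" "X \<subseteq> pverts G"
    and sp: "split_pair G X A B"
  obtains A1 A2 B1 B2 where "split_pair G X1 A1 B1" "split_pair G X2 A2 B2"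
    "A \<subseteq> A1 \<union> A2" "B1 \<subseteq> B \<union> A2" "B2 \<subseteq> B \<union> A1"
    "card A1 \<le> cut_rank G X1" "card B1 \<le> cut_rank G X1"
    "card A2 \<le> cut_rank G X2" "card B2 \<le> cut_rank G X2"
proof -
  have sub: "A \<subseteq> X" "B \<subseteq> pverts G - X" using split_pair_subsets[OF sp] by auto
  obtain A1 where A1: "A \<inter> X1 \<subseteq> A1" "A1 \<subseteq> X1" "inj_on (cut_row G X1) A1"
    "bits.independent (cut_row G X1 ` A1)"
    "cut_row G X1 ` X1 \<subseteq> bits.span (cut_row G X1 ` A1)" "card A1 = cut_rank G X1"
    by (rule split_pair_basis_of_child[of X1 X, OF _ sp]) (use X(1) in auto)
  obtain A2 where A2: "A \<inter> X2 \<subseteq> A2" "A2 \<subseteq> X2" "inj_on (cut_row G X2) A2"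
    "bits.independent (cut_row G X2 ` A2)"
    "cut_row G X2 ` X2 \<subseteq> bits.span (cut_row G X2 ` A2)" "card A2 = cut_rank G X2"
    by (rule split_pair_basis_of_child[of X2 X, OF _ sp]) (use X(1) in auto)
  have finite: "finite (B \<union> A1)" "finite (B \<union> A2)"
    "finite (cut_row G X1 ` X1)" "finite (cut_row G X2 ` X2)"
    using finite_subset[OF _ fin, of B] finite_subset[OF _ fin, of X1] finite_subset[OF _ fin, of X2]
      finite_subset[OF A1(2)] finite_subset[OF A2(2)] sub(2) X by auto
  have "\<forall>r \<in> bits.span (cut_row G X1 ` X1). (\<forall>b\<in>B \<union> A2. r b = 0) \<longrightarrow> r = 0"
    by (intro ballI impI) (rule separator_of_child[OF sym X sp A2(2,5)])
  then obtain B1 where B1: "B1 \<subseteq> B \<union> A2" "card B1 \<le> cut_rank G X1"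
    "\<forall>r \<in> bits.span (cut_row G X1 ` X1). (\<forall>b\<in>B1. r b = 0) \<longrightarrow> r = 0"
    unfolding cut_rank_def by (rule exists_small_separator[OF finite(3,2)])
  have X': "X = X2 \<union> X1" "X2 \<inter> X1 = {}" using X by auto
  have "\<forall>r \<in> bits.span (cut_row G X2 ` X2). (\<forall>b\<in>B \<union> A1. r b = 0) \<longrightarrow> r = 0"
    by (intro ballI impI) (rule separator_of_child[OF sym X' X(3) sp A1(2,5)])
  then obtain B2 where B2: "B2 \<subseteq> B \<union> A1" "card B2 \<le> cut_rank G X2"
    "\<forall>r \<in> bits.span (cut_row G X2 ` X2). (\<forall>b\<in>B2. r b = 0) \<longrightarrow> r = 0"
    unfolding cut_rank_def by (rule exists_small_separator[OF finite(4,1)])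
  have B_sub: "B1 \<subseteq> pverts G - X1" "B2 \<subseteq> pverts G - X2"
    using B1(1) B2(1) sub A1(2) A2(2) X by blast+
  have sp1: "split_pair G X1 A1 B1"
    unfolding split_pair_def by (intro conjI A1 B1(3) B_sub)
  have sp2: "split_pair G X2 A2 B2"
    unfolding split_pair_def by (intro conjI A2 B2(3) B_sub)
  have "A \<subseteq> A1 \<union> A2" using A1(1) A2(1) sub(1) X(1) by auto
  then show ?thesis
    by (rule that[OF sp1 sp2 _ B1(1) B2(1) _ B1(2) _ B2(2)]) (simp_all add: A1(6) A2(6))
qed

lemma split_pair_vertices: "split_pair G (pverts G) {} {}"
  unfolding split_pair_def
proof (intro conjI ballI impI)
  have 0: "cut_row G (pverts G) ` pverts G \<subseteq> {0}" by (auto simp: cut_row_def zero_fun_def)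
  then show "cut_row G (pverts G) ` pverts G \<subseteq> bits.span (cut_row G (pverts G) ` {})" by auto
  fix r assume "r \<in> bits.span (cut_row G (pverts G) ` pverts G)"
  then show "r = 0" using bits.span_mono[OF 0] by auto
qed (auto simp: bits.independent_empty)

section \<open>Vertex types and flips\<close>

text \<open>Positions of the tuple are recorded instead of vertices, so that types in different
  graphs can be compared.\<close>

definition nbr_type :: "'a pair_pre_digraph \<Rightarrow> 'a list \<Rightarrow> nat set \<Rightarrow> 'a \<Rightarrow> nat set" where
  "nbr_type G u J x = {j \<in> J. (x, u ! j) \<in> parcs G}"

text \<open>
  Degrees are taken into arbitrary sets \<open>\<L>\<close> of neighbourhood classes, so that the type for a subset
  of the index set is a function of the type, without summing over classes.
\<close>

definition vertex_type ::
  "'a pair_pre_digraph \<Rightarrow> 'a list \<Rightarrow> nat set \<Rightarrow> 'a \<Rightarrow> nat set \<times> (nat set set \<Rightarrow> nat)" where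
  "vertex_type G u J x =
     (nbr_type G u J x, \<lambda>\<L>. card {y \<in> pverts G. (x, y) \<in> parcs G \<and> nbr_type G u J y \<in> \<L>})"

definition type_restrict ::
  "nat set \<Rightarrow> nat set \<times> (nat set set \<Rightarrow> nat) \<Rightarrow> nat set \<times> (nat set set \<Rightarrow> nat)" where
  "type_restrict I t = (fst t \<inter> I, \<lambda>\<L>. snd t {M. M \<inter> I \<in> \<L>})"

lemma nbr_type_restrict: "I \<subseteq> J \<Longrightarrow> nbr_type G u I x = nbr_type G u J x \<inter> I"
  by (auto simp: nbr_type_def)

lemma vertex_type_restrict: "I \<subseteq> J \<Longrightarrow> vertex_type G u I x = type_restrict I (vertex_type G u J x)"
  by (simp add: vertex_type_def type_restrict_def nbr_type_restrict[of I J])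

lemma vertex_type_cong: "(\<And>j. j \<in> J \<Longrightarrow> u ! j = t ! j) \<Longrightarrow> vertex_type G u J = vertex_type G t J"
proof -
  assume "\<And>j. j \<in> J \<Longrightarrow> u ! j = t ! j"
  then have "nbr_type G u J = nbr_type G t J" by (auto simp: nbr_type_def fun_eq_iff)
  then show ?thesis by (simp add: vertex_type_def fun_eq_iff)
qed

lemma vertex_type_eq_nbr:
  "vertex_type G u J x = vertex_type H u' J x' \<Longrightarrow> nbr_type G u J x = nbr_type H u' J x'"
  by (simp add: vertex_type_def)

lemma vertex_type_eq_card:
  "vertex_type G u J x = vertex_type H u' J x' \<Longrightarrow>
    card {y \<in> pverts G. (x, y) \<in> parcs G \<and> nbr_type G u J y = L} =
    card {y \<in> pverts H. (x', y) \<in> parcs H \<and> nbr_type H u' J y = L}"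
  by (drule arg_cong[of _ _ "\<lambda>t. snd t {L}"]) (simp add: vertex_type_def)

lemma nbr_type_eq_adj:
  "nbr_type G u J x = nbr_type G u J x' \<Longrightarrow> b \<in> (!) u ` J \<Longrightarrow>
    (x, b) \<in> parcs G \<longleftrightarrow> (x', b) \<in> parcs G"
  by (auto simp: nbr_type_def set_eq_iff)

text \<open>Complementing the adjacency of the pairs of types related by \<open>F\<close> removes
  all edges between \<open>X\<close> and its complement exactly when \<open>F\<close> is adjacency
  there. Symmetry of \<open>F\<close> keeps the flipped graph undirected.\<close>

definition flip_separates ::
  "'a pair_pre_digraph \<Rightarrow> 'a list \<Rightarrow> nat set \<Rightarrow> 'a set \<Rightarrow>
    (nat set \<times> (nat set set \<Rightarrow> nat) \<Rightarrow> nat set \<times> (nat set set \<Rightarrow> nat) \<Rightarrow> bool) \<Rightarrow> bool" where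
  "flip_separates G u J X F \<longleftrightarrow> (\<forall>P Q. F P Q = F Q P) \<and>
     (\<forall>x\<in>X. \<forall>y\<in>pverts G - X. F (vertex_type G u J x) (vertex_type G u J y) \<longleftrightarrow> (x, y) \<in> parcs G)"

text \<open>One end point is exchanged at a time: \<open>x\<close> for \<open>x'\<close> using the
  columns in \<open>B\<close>, then \<open>y\<close> for \<open>y'\<close> using the rows in
  \<open>A\<close>.\<close>

lemma split_pair_crossing_same_side:
  assumes sym: "sym (parcs G)" and sp: "split_pair G X A B" "A \<union> B \<subseteq> (!) u ` J"
    and "x \<in> X" "x' \<in> X" "y \<in> pverts G - X" "y' \<in> pverts G - X"
    and "nbr_type G u J x = nbr_type G u J x'" "nbr_type G u J y = nbr_type G u J y'"
  shows "(x, y) \<in> parcs G \<longleftrightarrow> (x', y') \<in> parcs G"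
proof -
  have "(x, y) \<in> parcs G \<longleftrightarrow> (x', y) \<in> parcs G"
    by (rule split_pair_row_eq[OF sp(1)]) (use assms nbr_type_eq_adj[of G u J x x'] in auto)
  also have "\<dots> \<longleftrightarrow> (x', y') \<in> parcs G"
  proof (rule split_pair_column_eq[OF sp(1)])
    show "(a, y) \<in> parcs G \<longleftrightarrow> (a, y') \<in> parcs G" if "a \<in> A" for a
      using nbr_type_eq_adj[of G u J y y' a] assms that symD[OF sym] by blast
  qed (use assms in auto)
  finally show ?thesis .
qed

text \<open>
  If the two orientations of a pair of types across the cut disagreed, the degrees into the
  neighbourhood classes would force every vertex \<open>x\<close> of the first type to be adjacent within the
  class of \<open>y\<close> exactly to the vertices outside \<open>X\<close>, while \<open>y'\<close> in \<open>X\<close> is adjacent to \<open>x\<close>.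
\<close>

lemma split_pair_crossing_opposite:
  assumes sym: "sym (parcs G)" and fin: "finite (pverts G)" and X: "X \<subseteq> pverts G"
    and sp: "split_pair G X A B" "A \<union> B \<subseteq> (!) u ` J"
    and x: "x \<in> X" "x' \<in> pverts G - X" and y: "y \<in> pverts G - X" "y' \<in> X"
    and tx: "vertex_type G u J x = vertex_type G u J x'"
    and ty: "vertex_type G u J y = vertex_type G u J y'"
    and xy: "(x, y) \<in> parcs G"
  shows "(x', y') \<in> parcs G"
proof (rule ccontr)
  assume n: "(x', y') \<notin> parcs G"
  let ?n = "nbr_type G u J"
  define K L where "K = {z \<in> pverts G. ?n z = ?n x}" and "L = {z \<in> pverts G. ?n z = ?n y}"
  define N where "N z S = {w \<in> pverts G. (z, w) \<in> parcs G \<and> ?n w = S}" for z S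
  note same = split_pair_crossing_same_side[OF sym sp]
  note ntx = vertex_type_eq_nbr[OF tx] and nty = vertex_type_eq_nbr[OF ty]
  have in_adj: "(z, w) \<in> parcs G" if "z \<in> K \<inter> X" "w \<in> L - X" for z w
    using same[of x z y w] that x y xy by (auto simp: K_def L_def)
  have out_adj: "(w, z) \<notin> parcs G" if "z \<in> K - X" "w \<in> L \<inter> X" for z w
    using same[of y' w x' z] that x y n nty ntx symD[OF sym] by (auto simp: K_def L_def)
  have finN: "finite (N z S)" for z S using fin by (simp add: N_def)
  have Nx: "L - X \<subseteq> N x (?n y)"
    using in_adj x by (auto simp: N_def L_def K_def X[THEN subsetD])
  have Nx': "N x' (?n y) \<subseteq> L - X"
    using out_adj[of x'] x ntx symD[OF sym] by (auto simp: N_def L_def K_def)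
  have "card (N x (?n y)) = card (N x' (?n y))"
    unfolding N_def by (rule vertex_type_eq_card[OF tx])
  also have "\<dots> \<le> card (L - X)" using Nx' fin by (intro card_mono) (auto simp: L_def)
  finally have "L - X = N x (?n y)" using card_seteq[OF finN Nx] by simp
  then have nxy': "(x, y') \<notin> parcs G"
    using y X nty by (auto simp: N_def L_def)
  have Ny: "K \<inter> X \<subseteq> N y (?n x)"
    using in_adj[of _ y] y symD[OF sym] by (auto simp: N_def L_def K_def)
  have Ny': "N y' (?n x) \<subseteq> K \<inter> X"
    using out_adj[of _ y'] y nty X by (auto simp: N_def L_def K_def)
  have "card (K \<inter> X) \<le> card (N y (?n x))" by (rule card_mono[OF finN Ny])
  also have "\<dots> = card (N y' (?n x))"
    unfolding N_def by (rule vertex_type_eq_card[OF ty])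
  finally have "N y' (?n x) = K \<inter> X"
    using fin by (intro card_seteq[OF _ Ny']) (auto simp: K_def)
  then have "(y', x) \<in> parcs G" using x X by (auto simp: N_def K_def)
  then show False using nxy' symD[OF sym] by blast
qed

text \<open>If the second pair crosses the cut in the other direction, the previous lemma gives only
  one implication; the converse is the same lemma with the two pairs interchanged.\<close>

lemma split_pair_crossing_determined:
  assumes sym: "sym (parcs G)" and fin: "finite (pverts G)" and X: "X \<subseteq> pverts G"
    and sp: "split_pair G X A B" "A \<union> B \<subseteq> (!) u ` J"
    and x: "x \<in> X" "y \<in> pverts G - X"
    and x': "x' \<in> pverts G" "y' \<in> pverts G" "x' \<in> X \<longleftrightarrow> y' \<notin> X"
    and tx: "vertex_type G u J x = vertex_type G u J x'"
    and ty: "vertex_type G u J y = vertex_type G u J y'"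
  shows "(x, y) \<in> parcs G \<longleftrightarrow> (x', y') \<in> parcs G"
proof (cases "x' \<in> X")
  case True
  then show ?thesis
    using split_pair_crossing_same_side[OF sym sp, of x x' y y']
      vertex_type_eq_nbr[OF tx] vertex_type_eq_nbr[OF ty] x x' by blast
next
  case False
  have "(x', y') \<in> parcs G" if "(x, y) \<in> parcs G"
    using split_pair_crossing_opposite[OF sym fin X sp x(1) _ x(2) _ tx ty that] False x' by blast
  moreover have "(y, x) \<in> parcs G" if "(y', x') \<in> parcs G"
    using split_pair_crossing_opposite[OF sym fin X sp _ x(2) _ x(1) ty[symmetric] tx[symmetric] that]
      False x' by blast
  ultimately show ?thesis using symD[OF sym] by blast
qed

text \<open>\<open>F\<close> consists of the unordered pairs of types realised by some edge across
  the cut. By the previous lemma such a pair is realised by crossing edges only, never also by a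
  crossing non-edge.\<close>

lemma exists_separating_flip:
  assumes sym: "sym (parcs G)" and fin: "finite (pverts G)" and X: "X \<subseteq> pverts G"
    and sp: "split_pair G X A B" "A \<union> B \<subseteq> (!) u ` J"
  shows "\<exists>F. flip_separates G u J X F"
proof -
  let ?t = "vertex_type G u J"
  define F where "F P Q \<longleftrightarrow> (\<exists>x\<in>X. \<exists>y\<in>pverts G - X. (x, y) \<in> parcs G \<and>
    (?t x = P \<and> ?t y = Q \<or> ?t x = Q \<and> ?t y = P))" for P Q
  have "F (?t x) (?t y) \<longleftrightarrow> (x, y) \<in> parcs G" if xy: "x \<in> X" "y \<in> pverts G - X" for x y
  proof
    assume "F (?t x) (?t y)"
    then obtain x' y' where *: "x' \<in> X" "y' \<in> pverts G - X" "(x', y') \<in> parcs G"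
      "?t x' = ?t x \<and> ?t y' = ?t y \<or> ?t x' = ?t y \<and> ?t y' = ?t x"
      unfolding F_def by blast
    then show "(x, y) \<in> parcs G"
      using split_pair_crossing_determined[OF sym fin X sp *(1,2), of x y]
        split_pair_crossing_determined[OF sym fin X sp *(1,2), of y x] xy X symD[OF sym]
      by blast
  qed (use xy in \<open>auto simp: F_def\<close>)
  moreover have "F P Q = F Q P" for P Q unfolding F_def by blast
  ultimately show ?thesis unfolding flip_separates_def by blast
qed

text \<open>
  The flips of the two children agree wherever they have to: on the types of two vertices that lie
  on different sides of two of the cuts both are the adjacency of these vertices.
\<close>

lemma exists_common_flip:
  assumes sym: "sym (parcs G)" and X: "X = X1 \<union> X2" "X1 \<inter> X2 = {}" "X \<subseteq> pverts G"
    and IJ: "I1 \<subseteq> J" "I2 \<subseteq> J" "I \<subseteq> J"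
    and F1: "flip_separates G u I1 X1 F1" and F2: "flip_separates G u I2 X2 F2"
    and F: "flip_separates G u I X F"
  obtains F' where "\<And>P Q. F' P Q = F' Q P"
    "\<And>x y. x \<in> X1 \<Longrightarrow> y \<in> pverts G \<Longrightarrow> F' (vertex_type G u J x) (vertex_type G u J y) =
       F1 (vertex_type G u I1 x) (vertex_type G u I1 y)"
    "\<And>x y. x \<in> X2 \<Longrightarrow> y \<in> pverts G \<Longrightarrow> F' (vertex_type G u J x) (vertex_type G u J y) =
       F2 (vertex_type G u I2 x) (vertex_type G u I2 y)"
proof
  let ?t = "vertex_type G u J"
  \<comment> \<open>Precedence is given to \<open>F1\<close> as soon as one of the types occurs in
    \<open>X1\<close>. The claim for \<open>X1\<close> is then immediate, and the one for
    \<open>X2\<close> has to be checked only for types shared with \<open>X1\<close>.\<close>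
  define F' where "F' P Q \<longleftrightarrow> (if \<exists>x\<in>X1. ?t x = P \<or> ?t x = Q
    then F1 (type_restrict I1 P) (type_restrict I1 Q) else F2 (type_restrict I2 P) (type_restrict I2 Q))"
    for P Q
  have cross1: "F1 (vertex_type G u I1 x) (vertex_type G u I1 y) \<longleftrightarrow> (x, y) \<in> parcs G"
    if "x \<in> X1" "y \<in> pverts G - X1" for x y
    using F1 that unfolding flip_separates_def by blast
  have cross2: "F2 (vertex_type G u I2 x) (vertex_type G u I2 y) \<longleftrightarrow> (x, y) \<in> parcs G"
    if "x \<in> X2" "y \<in> pverts G - X2" for x y
    using F2 that unfolding flip_separates_def by blast
  have cross: "F (vertex_type G u I x) (vertex_type G u I y) \<longleftrightarrow> (x, y) \<in> parcs G"
    if "x \<in> X" "y \<in> pverts G - X" for x y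
    using F that unfolding flip_separates_def by blast
  have F1_sym: "F1 P Q = F1 Q P" and F2_sym: "F2 P Q = F2 Q P" for P Q
    using F1 F2 unfolding flip_separates_def by blast+
  have restrict: "vertex_type G u I1 x = type_restrict I1 (?t x)"
    "vertex_type G u I2 x = type_restrict I2 (?t x)" "vertex_type G u I x = type_restrict I (?t x)" for x
    using IJ by (simp_all add: vertex_type_restrict)
  have adj_sym: "(x, y) \<in> parcs G \<longleftrightarrow> (y, x) \<in> parcs G" for x y
    using symD[OF sym] by blast
  show "F' P Q = F' Q P" for P Q
    using F1_sym[of "type_restrict I1 P"] F2_sym[of "type_restrict I2 P"] unfolding F'_def by auto
  show "F' (?t x) (?t y) = F1 (vertex_type G u I1 x) (vertex_type G u I1 y)" if "x \<in> X1" for x y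
    unfolding F'_def restrict using that by auto
  show "F' (?t x) (?t y) = F2 (vertex_type G u I2 x) (vertex_type G u I2 y)"
    if x: "x \<in> X2" and y: "y \<in> pverts G" for x y
  proof (cases "\<exists>z\<in>X1. ?t z = ?t x \<or> ?t z = ?t y")
    case False
    then show ?thesis unfolding F'_def restrict by auto
  next
    case True
    have "F1 (vertex_type G u I1 x) (vertex_type G u I1 y) =
      F2 (vertex_type G u I2 x) (vertex_type G u I2 y)"
    proof (cases "\<exists>z\<in>X1. ?t z = ?t y")
      case True
      then obtain z where z: "z \<in> X1" "?t z = ?t y" by blast
      have "F1 (vertex_type G u I1 x) (vertex_type G u I1 z) \<longleftrightarrow> (z, x) \<in> parcs G"
        using cross1[of z x] F1_sym z x X by blast
      moreover have "F2 (vertex_type G u I2 x) (vertex_type G u I2 z) \<longleftrightarrow> (x, z) \<in> parcs G"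
        using cross2[of x z] z x X by blast
      ultimately show ?thesis unfolding restrict z(2) using adj_sym by blast
    next
      case no_y: False
      then obtain z where z: "z \<in> X1" "?t z = ?t x" using True by blast
      have "y \<notin> X1" using no_y by blast
      then have 1: "F1 (vertex_type G u I1 z) (vertex_type G u I1 y) \<longleftrightarrow> (z, y) \<in> parcs G"
        using cross1[of z y] z y by blast
      have "F2 (vertex_type G u I2 z) (vertex_type G u I2 y) \<longleftrightarrow> (z, y) \<in> parcs G"
      proof (cases "y \<in> X2")
        case True
        then have "F2 (vertex_type G u I2 y) (vertex_type G u I2 z) \<longleftrightarrow> (y, z) \<in> parcs G"
          using cross2[of y z] z X by blast
        then show ?thesis using F2_sym adj_sym by blast
      next
        case False
        \<comment> \<open>Here the flip of the parent is used: \<open>x\<close> and \<open>z\<close>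
          have the same type and both lie in \<open>X\<close>, so they have the same adjacency to
          \<open>y\<close> outside \<open>X\<close>.\<close>
        then have y': "y \<in> pverts G - X" using \<open>y \<notin> X1\<close> y X by blast
        have "F2 (vertex_type G u I2 x) (vertex_type G u I2 y) \<longleftrightarrow> (x, y) \<in> parcs G"
          using cross2[of x y] x y False by blast
        moreover have "F (vertex_type G u I x) (vertex_type G u I y) \<longleftrightarrow> (x, y) \<in> parcs G"
          "F (vertex_type G u I z) (vertex_type G u I y) \<longleftrightarrow> (z, y) \<in> parcs G"
          using cross[of x y] cross[of z y] x z y' X by blast+
        ultimately show ?thesis unfolding restrict z(2) by blast
      qed
      then show ?thesis using 1 unfolding restrict z(2) by blast
    qed
    then show ?thesis using True unfolding F'_def restrict by auto
  qed
qed

section \<open>Matching components\<close>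

text \<open>
  After removing a matched pair of blocks \<open>C\<close>, \<open>C'\<close> of equal size, the elements outside \<open>C\<close> that
  \<open>h\<close> sends into \<open>C'\<close> are redirected to the images outside \<open>C'\<close> of elements of \<open>C\<close>.
\<close>

lemma redirect_bij:
  assumes h: "bij_betw h P P'" and fin: "finite P" and C: "C \<subseteq> P" "C' \<subseteq> P'" "card C = card C'"
  obtains h' where "bij_betw h' (P - C) (P' - C')"
    "\<And>x. x \<in> P - C \<Longrightarrow> h' x = h x \<or> h x \<in> C' \<and> (\<exists>y\<in>C. h' x = h y)"
proof -
  define N where "N = {x \<in> P - C. h x \<in> C'}"
  define M where "M = {y \<in> C. h y \<notin> C'}"
  have inj: "inj_on h P" and im: "h ` P = P'" using h by (auto simp: bij_betw_def)
  have finC: "finite C" using C(1) fin finite_subset by blast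
  \<comment> \<open>The preimage of \<open>C'\<close> is \<open>C\<close> with \<open>M\<close>
    replaced by \<open>N\<close>; since \<open>C\<close> and \<open>C'\<close> have equal size, so
    have \<open>M\<close> and \<open>N\<close>.\<close>
  have "h ` ((C - M) \<union> N) = C'" using im C by (auto simp: N_def M_def image_iff)
  moreover have sub: "(C - M) \<union> N \<subseteq> P" using C by (auto simp: N_def)
  ultimately have "card ((C - M) \<union> N) = card C'" using inj by (metis card_image inj_on_subset)
  moreover have "card ((C - M) \<union> N) = card (C - M) + card N"
    by (rule card_Un_disjoint) (use fin finC in \<open>auto simp: N_def\<close>)
  moreover have "card (C - M) + card M = card C"
    using finC card_Diff_subset[of M C] card_mono[of C M] by (auto simp: M_def)
  ultimately have "card N = card M" using C(3) by linarith
  then obtain k where k: "bij_betw k N M"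
    using finite_same_card_bij[of N M] fin finC by (auto simp: N_def M_def)
  define h' where "h' x = (if x \<in> N then h (k x) else h x)" for x
  have "bij_betw h (P - C - N) (h ` (P - C - N))"
    using inj by (auto simp: bij_betw_def intro: inj_on_subset)
  then have 1: "bij_betw h' (P - C - N) (h ` (P - C - N))"
    by (subst bij_betw_cong[of _ _ h]) (auto simp: h'_def)
  have "bij_betw h M (h ` M)"
    using inj C(1) by (auto simp: bij_betw_def M_def intro: inj_on_subset)
  then have "bij_betw (h \<circ> k) N (h ` M)" by (rule bij_betw_trans[OF k])
  then have 2: "bij_betw h' N (h ` M)"
    by (subst bij_betw_cong[of _ _ "h \<circ> k"]) (auto simp: h'_def)
  have "h ` (P - C - N) \<inter> h ` M = {}"
    using inj C(1) by (auto simp: M_def inj_on_def)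
  from bij_betw_combine[OF 1 2 this]
  have "bij_betw h' (P - C - N \<union> N) (h ` (P - C - N) \<union> h ` M)" .
  moreover have "P - C - N \<union> N = P - C" by (auto simp: N_def)
  moreover have "h ` (P - C - N) \<union> h ` M = P' - C'"
    using im C by (auto simp: N_def M_def image_iff)
  ultimately have "bij_betw h' (P - C) (P' - C')" by simp
  moreover have "h' x = h x \<or> h x \<in> C' \<and> (\<exists>y\<in>C. h' x = h y)" if "x \<in> P - C" for x
    using bij_betwE[OF k] by (auto simp: h'_def N_def M_def)
  ultimately show ?thesis by (rule that)
qed

text \<open>\<open>h\<close> relates each block to the block of an image of each of its elements but
  may tear blocks apart. A related pair of blocks is removed and \<open>h\<close> is redirected
  around it; \<open>R_trans\<close> says that \<open>R\<close> behaves like an equivalence between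
  two different universes, so that redirected elements still have related blocks.\<close>

lemma block_matching:
  assumes "finite P" "bij_betw h P P'"
    and "\<And>x. x \<in> P \<Longrightarrow> x \<in> blk x \<and> blk x \<subseteq> P" "\<And>x y. y \<in> blk x \<Longrightarrow> blk y = blk x"
    and "\<And>x. x \<in> P' \<Longrightarrow> x \<in> blk' x \<and> blk' x \<subseteq> P'" "\<And>x y. y \<in> blk' x \<Longrightarrow> blk' y = blk' x"
    and "\<And>x. x \<in> P \<Longrightarrow> R (blk x) (blk' (h x))"
    and R_card: "\<And>C C'. R C C' \<Longrightarrow> card C = card C'"
    and R_trans: "\<And>C C' D D'. R C C' \<Longrightarrow> R D C' \<Longrightarrow> R D D' \<Longrightarrow> R C D'"
  shows "\<exists>\<beta>. bij_betw \<beta> (blk ` P) (blk' ` P') \<and> (\<forall>C\<in>blk ` P. R C (\<beta> C)) \<and>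
    (a \<in> P \<longrightarrow> \<beta> (blk a) = blk' (h a))"
  using assms(1-7)
proof (induction "card P" arbitrary: P P' h a rule: less_induct)
  case less
  note blkP = less.prems(3) and blk = less.prems(4) and blkP' = less.prems(5) and blk' = less.prems(6)
  show ?case
  proof (cases "P = {}")
    case True
    then have "P' = {}" using less.prems(2) by (auto simp: bij_betw_def)
    then show ?thesis using True by (auto simp: bij_betw_def)
  next
    case False
    \<comment> \<open>Removing the block of \<open>a\<close> first fixes its partner as the block of
      \<open>h a\<close>.\<close>
    then obtain b where b: "b \<in> P" "a \<in> P \<longrightarrow> b = a" by blast
    have hb: "h b \<in> P'" using less.prems(2) b(1) by (auto simp: bij_betw_def)
    define C C' where "C = blk b" and "C' = blk' (h b)"
    have CC': "R C C'" using less.prems(7) b(1) by (simp add: C_def C'_def)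
    have C: "b \<in> C" "C \<subseteq> P" using blkP b(1) by (auto simp: C_def)
    have C': "C' \<subseteq> P'" using blkP' hb by (auto simp: C'_def)
    obtain h' where h': "bij_betw h' (P - C) (P' - C')"
      "\<And>x. x \<in> P - C \<Longrightarrow> h' x = h x \<or> h x \<in> C' \<and> (\<exists>y\<in>C. h' x = h y)"
      by (rule redirect_bij[OF less.prems(2,1) C(2) C' R_card[OF CC']]) (rule that)
    have outC: "blk x \<subseteq> P - C" if "x \<in> P - C" for x
    proof
      fix y assume y: "y \<in> blk x"
      have "x \<in> blk x" "y \<in> P" using blkP[of x] that y by blast+
      moreover have "y \<notin> C" using blk[OF y] blk[of y b] calculation(1) that by (metis C_def DiffD2)
      ultimately show "y \<in> P - C" by blast
    qed
    have outC': "blk' x \<subseteq> P' - C'" if "x \<in> P' - C'" for x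
    proof
      fix y assume y: "y \<in> blk' x"
      have "x \<in> blk' x" "y \<in> P'" using blkP'[of x] that y by blast+
      moreover have "y \<notin> C'" using blk'[OF y] blk'[of y "h b"] calculation(1) that by (metis C'_def DiffD2)
      ultimately show "y \<in> P' - C'" by blast
    qed
    have R: "R (blk x) (blk' (h' x))" if x: "x \<in> P - C" for x
    proof (cases "h' x = h x")
      case True
      then show ?thesis using less.prems(7) x by simp
    next
      case False
      then obtain y where y: "h x \<in> C'" "y \<in> C" "h' x = h y" using h'(2)[OF x] by blast
      have "blk' (h x) = C'" using blk'[of "h x" "h b"] y(1) by (metis C'_def)
      then have "R (blk x) C'" using less.prems(7)[of x] x by auto
      \<comment> \<open>The chain from \<open>blk x\<close> to \<open>C'\<close>, back to
        \<open>C\<close>, and on to \<open>blk' (h y)\<close> is what \<open>R_trans\<close>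
        closes.\<close>
      moreover have "R C (blk' (h y))"
        using less.prems(7)[of y] y(2) C(2) blk[of y b] by (metis C_def subsetD)
      ultimately show ?thesis using R_trans CC' y(3) by metis
    qed
    have "card (P - C) < card P"
      using C b(1) less.prems(1) by (intro psubset_card_mono) auto
    moreover have "finite (P - C)" using less.prems(1) by simp
    moreover note h'(1)
    moreover have "x \<in> blk x \<and> blk x \<subseteq> P - C" if "x \<in> P - C" for x
      using outC[OF that] blkP[of x] that by simp
    moreover note blk
    moreover have "x \<in> blk' x \<and> blk' x \<subseteq> P' - C'" if "x \<in> P' - C'" for x
      using outC'[OF that] blkP'[of x] that by simp
    moreover note blk' R
    ultimately have "\<exists>\<beta>. bij_betw \<beta> (blk ` (P - C)) (blk' ` (P' - C')) \<and>
      (\<forall>D\<in>blk ` (P - C). R D (\<beta> D)) \<and> (a \<in> P - C \<longrightarrow> \<beta> (blk a) = blk' (h' a))"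
      by (rule less.hyps)
    then obtain \<beta> where \<beta>: "bij_betw \<beta> (blk ` (P - C)) (blk' ` (P' - C'))"
      "\<forall>D\<in>blk ` (P - C). R D (\<beta> D)" by blast
    have imP: "blk ` P = insert C (blk ` (P - C))"
    proof -
      have "blk x = C" if "x \<in> C" for x using blk[of x b] that by (simp only: C_def)
      then show ?thesis using C by blast
    qed
    have imP': "blk' ` P' = insert C' (blk' ` (P' - C'))"
    proof -
      have "blk' x = C'" if "x \<in> C'" for x using blk'[of x "h b"] that by (simp only: C'_def)
      moreover have "h b \<in> C'" using blkP'[OF hb] by (simp add: C'_def)
      ultimately show ?thesis using C' hb by blast
    qed
    have notin: "C \<notin> blk ` (P - C)" using outC C(1) by auto
    have notin': "C' \<notin> blk' ` (P' - C')" using outC' blkP' by blast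
    have "bij_betw (\<beta>(C := C')) (blk ` (P - C)) (blk' ` (P' - C'))"
      using \<beta>(1) notin by (subst bij_betw_cong[of _ _ \<beta>]) auto
    then have "bij_betw (\<beta>(C := C')) (insert C (blk ` (P - C))) (insert C' (blk' ` (P' - C')))"
      using notIn_Un_bij_betw[OF notin, of "\<beta>(C := C')"] notin' by simp
    then have "bij_betw (\<beta>(C := C')) (blk ` P) (blk' ` P')" unfolding imP imP' .
    moreover have "\<forall>D\<in>blk ` P. R D ((\<beta>(C := C')) D)" unfolding imP using \<beta>(2) CC' notin by auto
    moreover have "a \<in> P \<longrightarrow> (\<beta>(C := C')) (blk a) = blk' (h a)" using b by (auto simp: C_def C'_def)
    ultimately show ?thesis by blast
  qed
qed

text \<open>Adjacency is negated exactly where \<open>F\<close> holds. As \<open>F\<close> acts on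
  types, one \<open>F\<close> flips both graphs.\<close>

definition flip_adj ::
  "'a pair_pre_digraph \<Rightarrow> 'a list \<Rightarrow> nat set \<Rightarrow>
    (nat set \<times> (nat set set \<Rightarrow> nat) \<Rightarrow> nat set \<times> (nat set set \<Rightarrow> nat) \<Rightarrow> bool) \<Rightarrow> 'a \<Rightarrow> 'a \<Rightarrow> bool" where
  "flip_adj G u J F x y \<longleftrightarrow> x \<in> pverts G \<and> y \<in> pverts G \<and>
     ((x, y) \<in> parcs G \<longleftrightarrow> \<not> F (vertex_type G u J x) (vertex_type G u J y))"

section \<open>Connected components of flipped graphs\<close>

definition reach :: "('a \<Rightarrow> 'a \<Rightarrow> bool) \<Rightarrow> 'a \<Rightarrow> 'a set" where
  "reach R x = {y. R\<^sup>*\<^sup>* x y}"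

lemma reach_self: "x \<in> reach R x"
  by (simp add: reach_def)

lemma reach_subset:
  assumes "x \<in> X" "\<And>y z. y \<in> X \<Longrightarrow> R y z \<Longrightarrow> z \<in> X"
  shows "reach R x \<subseteq> X"
proof
  fix y assume "y \<in> reach R x"
  then have "R\<^sup>*\<^sup>* x y" by (simp add: reach_def)
  then show "y \<in> X" by induction (use assms in auto)
qed

lemma reach_step: "y \<in> reach R x \<Longrightarrow> R y z \<Longrightarrow> z \<in> reach R x"
  by (simp add: reach_def)

lemma reach_eq:
  assumes "\<And>x y. R x y \<Longrightarrow> R y x" "y \<in> reach R x"
  shows "reach R y = reach R x"
proof -
  have "symp R" using assms(1) by (simp add: sympI)
  then have "symp R\<^sup>*\<^sup>*" by (rule symp_rtranclp)
  then have "R\<^sup>*\<^sup>* x z \<longleftrightarrow> R\<^sup>*\<^sup>* y z" for z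
    using assms(2) by (metis mem_Collect_eq reach_def rtranclp_trans sympD)
  then show ?thesis by (simp add: reach_def)
qed

lemma reach_mono_on:
  assumes "x \<in> X" "\<And>y z. y \<in> X \<Longrightarrow> R y z \<Longrightarrow> z \<in> X" "\<And>y z. y \<in> X \<Longrightarrow> R y z \<longleftrightarrow> S y z"
  shows "reach R x = reach S x"
proof
  have "reach R x \<subseteq> X \<inter> reach S x"
  proof (rule reach_subset)
    show "x \<in> X \<inter> reach S x" using assms(1) reach_self by (rule IntI)
    show "z \<in> X \<inter> reach S x" if "y \<in> X \<inter> reach S x" "R y z" for y z
      using that assms(2)[of y z] assms(3)[of y z] reach_step[of y S x z] by simp
  qed
  then show "reach R x \<subseteq> reach S x" by blast
  have "reach S x \<subseteq> X \<inter> reach R x"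
  proof (rule reach_subset)
    show "x \<in> X \<inter> reach R x" using assms(1) reach_self by (rule IntI)
    show "z \<in> X \<inter> reach R x" if "y \<in> X \<inter> reach R x" "S y z" for y z
      using that assms(2)[of y z] assms(3)[of y z] reach_step[of y R x z] by simp
  qed
  then show "reach S x \<subseteq> reach R x" by blast
qed

lemma reach_bij:
  assumes g: "bij_betw g P P'" and a: "a \<in> P"
    and closed: "\<And>x y. x \<in> P \<Longrightarrow> R x y \<Longrightarrow> y \<in> P" "\<And>x y. x \<in> P' \<Longrightarrow> R' x y \<Longrightarrow> y \<in> P'"
    and eq: "\<And>x y. x \<in> P \<Longrightarrow> y \<in> P \<Longrightarrow> R x y \<longleftrightarrow> R' (g x) (g y)"
  shows "bij_betw g (reach R a) (reach R' (g a))"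
proof -
  have sub: "reach R a \<subseteq> P" by (rule reach_subset[OF a closed(1)])
  have "reach R a \<subseteq> {x \<in> P. g x \<in> reach R' (g a)}"
  proof (rule reach_subset)
    show "a \<in> {x \<in> P. g x \<in> reach R' (g a)}" using a reach_self[of "g a" R'] by simp
    show "z \<in> {x \<in> P. g x \<in> reach R' (g a)}"
      if "y \<in> {x \<in> P. g x \<in> reach R' (g a)}" "R y z" for y z
      using that closed(1)[of y z] eq[of y z] reach_step[of "g y" R' "g a" "g z"] by simp
  qed
  moreover have "reach R' (g a) \<subseteq> g ` reach R a"
  proof (rule reach_subset)
    show "g a \<in> g ` reach R a" using reach_self by (rule imageI)
    fix y z assume y: "y \<in> g ` reach R a" "R' y z"
    then obtain x where x: "x \<in> reach R a" "y = g x" by blast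
    have "y \<in> P'" using x sub g by (auto simp: bij_betw_def)
    then have "z \<in> P'" using closed(2)[of y z] y(2) by simp
    then obtain w where w: "w \<in> P" "z = g w" using g by (auto simp: bij_betw_def)
    then have "R x w" using eq[of x w] x sub y(2) by auto
    then show "z \<in> g ` reach R a" using reach_step[OF x(1), of w] w(2) by simp
  qed
  ultimately have "g ` reach R a = reach R' (g a)" by blast
  then show "bij_betw g (reach R a) (reach R' (g a))"
    using g sub by (auto simp: bij_betw_def intro: inj_on_subset)
qed

text \<open>The types are those in the whole graphs, not in the parts \<open>C\<close> and
  \<open>C'\<close>, so they carry the information on how the parts are joined to the rest.\<close>

definition part_iso ::
  "'a pair_pre_digraph \<Rightarrow> ('a \<Rightarrow> 'c) \<Rightarrow> 'a list \<Rightarrow> 'b pair_pre_digraph \<Rightarrow> ('b \<Rightarrow> 'c) \<Rightarrow> 'b list \<Rightarrow>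
    nat set \<Rightarrow> 'a set \<Rightarrow> 'b set \<Rightarrow> ('a \<Rightarrow> 'b) \<Rightarrow> bool" where
  "part_iso G c u H d u' J C C' g \<longleftrightarrow> bij_betw g C C' \<and>
     (\<forall>x\<in>C. d (g x) = c x \<and> vertex_type H u' J (g x) = vertex_type G u J x) \<and>
     (\<forall>x\<in>C. \<forall>y\<in>C. (x, y) \<in> parcs G \<longleftrightarrow> (g x, g y) \<in> parcs H)"

lemma part_isoD:
  assumes "part_iso G c u H d u' J C C' g"
  shows "bij_betw g C C'"
    and "x \<in> C \<Longrightarrow> d (g x) = c x"
    and "x \<in> C \<Longrightarrow> vertex_type H u' J (g x) = vertex_type G u J x"
    and "x \<in> C \<Longrightarrow> y \<in> C \<Longrightarrow> (x, y) \<in> parcs G \<longleftrightarrow> (g x, g y) \<in> parcs H"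
  using assms by (auto simp: part_iso_def)

text \<open>The two sides live in different graphs, so transitivity takes this zigzag form; it is
  the instance of \<open>R_trans\<close> in \<open>block_matching\<close>.\<close>

lemma part_iso_difunctional:
  assumes 1: "part_iso G c u H d u' J C C' g1" and 2: "part_iso G c u H d u' J D C' g2"
    and 3: "part_iso G c u H d u' J D D' g3"
  shows "part_iso G c u H d u' J C D' (g3 \<circ> inv_into D g2 \<circ> g1)"
proof -
  let ?i = "inv_into D g2"
  note bij = part_isoD(1)[OF 1] part_isoD(1)[OF 2] part_isoD(1)[OF 3]
  have biji: "bij_betw ?i C' D" by (rule bij_betw_inv_into[OF bij(2)])
  have D: "?i (g1 x) \<in> D" "g2 (?i (g1 x)) = g1 x" if "x \<in> C" for x
    using bij_betwE[OF bij(1)] bij_betwE[OF biji] bij_betw_inv_into_right[OF bij(2)] that by auto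
  have "bij_betw (g3 \<circ> (?i \<circ> g1)) C D'"
    by (rule bij_betw_trans[OF bij_betw_trans[OF bij(1) biji] bij(3)])
  moreover have "d (g3 (?i (g1 x))) = c x" if "x \<in> C" for x
    using part_isoD(2)[OF 1 that] part_isoD(2)[OF 2 D(1)[OF that]] part_isoD(2)[OF 3 D(1)[OF that]]
      D(2)[OF that] by simp
  moreover have "vertex_type H u' J (g3 (?i (g1 x))) = vertex_type G u J x" if "x \<in> C" for x
    using part_isoD(3)[OF 1 that] part_isoD(3)[OF 2 D(1)[OF that]] part_isoD(3)[OF 3 D(1)[OF that]]
      D(2)[OF that] by simp
  moreover have "(x, y) \<in> parcs G \<longleftrightarrow> (g3 (?i (g1 x)), g3 (?i (g1 y))) \<in> parcs H"
    if "x \<in> C" "y \<in> C" for x y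
    using part_isoD(4)[OF 1 that] part_isoD(4)[OF 2 D(1)[OF that(1)] D(1)[OF that(2)]]
      part_isoD(4)[OF 3 D(1)[OF that(1)] D(1)[OF that(2)]] D(2)[OF that(1)] D(2)[OF that(2)] by simp
  ultimately show ?thesis unfolding part_iso_def by (simp add: comp_assoc)
qed

lemma flip_adj_sym:
  assumes "sym (parcs G)" "\<And>P Q. F P Q = F Q P"
  shows "flip_adj G u J F x y \<Longrightarrow> flip_adj G u J F y x"
  using assms(2)[of "vertex_type G u J x"] symD[OF assms(1), of x y] symD[OF assms(1), of y x]
  unfolding flip_adj_def by auto

text \<open>Vertices in different components are not adjacent after the flip, so their adjacency is
  given by \<open>F\<close> on their types. Type-preserving isomorphisms of the components therefore
  fit together, whatever bijection of components is used; one with isomorphic partners is supplied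
  by \<open>block_matching\<close>.\<close>

lemma glue_components:
  assumes sym: "sym (parcs G)" "sym (parcs H)" "\<And>P Q. F P Q = F Q P" and fin: "finite P"
    and P: "P \<subseteq> pverts G" "\<And>x y. x \<in> P \<Longrightarrow> flip_adj G u J F x y \<Longrightarrow> y \<in> P"
    and P': "P' \<subseteq> pverts H" "\<And>x y. x \<in> P' \<Longrightarrow> flip_adj H u' J F x y \<Longrightarrow> y \<in> P'"
    and h: "bij_betw h P P'"
    and iso: "\<And>x. x \<in> P \<Longrightarrow>
      \<exists>g. part_iso G c u H d u' J (reach (flip_adj G u J F) x) (reach (flip_adj H u' J F) (h x)) g \<and> g x = h x"
  shows "\<exists>g. part_iso G c u H d u' J P P' g \<and> (a \<in> P \<longrightarrow> g a = h a)"
proof -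
  let ?S = "flip_adj G u J F" and ?S' = "flip_adj H u' J F"
  let ?blk = "reach ?S" and ?blk' = "reach ?S'"
  let ?R = "\<lambda>C C'. \<exists>g. part_iso G c u H d u' J C C' g"
  note S_sym = flip_adj_sym[OF sym(1,3)] and S'_sym = flip_adj_sym[OF sym(2,3)]
  have blk: "x \<in> ?blk x \<and> ?blk x \<subseteq> P" if "x \<in> P" for x
    by (intro conjI reach_self reach_subset[OF that P(2)])
  have blk': "x \<in> ?blk' x \<and> ?blk' x \<subseteq> P'" if "x \<in> P'" for x
    by (intro conjI reach_self reach_subset[OF that P'(2)])
  have blk_eq: "?blk y = ?blk x" if "y \<in> ?blk x" for x y
    by (rule reach_eq[OF S_sym that])
  have blk'_eq: "?blk' y = ?blk' x" if "y \<in> ?blk' x" for x y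
    by (rule reach_eq[OF S'_sym that])
  have card: "card C = card C'" if "?R C C'" for C C'
    using that by (elim exE) (rule bij_betw_same_card[OF part_isoD(1)])
  have trans: "?R C D'" if "?R C C'" "?R D C'" "?R D D'" for C C' D D'
    using that by (elim exE) (rule exI, rule part_iso_difunctional)
  have Rh: "?R (?blk x) (?blk' (h x))" if "x \<in> P" for x
    using iso[OF that] by (elim exE conjE) (rule exI)
  have "\<exists>\<beta>. bij_betw \<beta> (?blk ` P) (?blk' ` P') \<and> (\<forall>C\<in>?blk ` P. ?R C (\<beta> C)) \<and>
    (a \<in> P \<longrightarrow> \<beta> (?blk a) = ?blk' (h a))"
    by (rule block_matching[where blk = ?blk and blk' = ?blk' and R = ?R,
          OF fin h blk blk_eq blk' blk'_eq Rh card trans])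
  then obtain \<beta> where \<beta>: "bij_betw \<beta> (?blk ` P) (?blk' ` P')" "\<forall>C\<in>?blk ` P. ?R C (\<beta> C)"
    "a \<in> P \<longrightarrow> \<beta> (?blk a) = ?blk' (h a)"
    by (elim exE conjE) (rule that)
  have "\<exists>g. part_iso G c u H d u' J C (\<beta> C) g \<and> (a \<in> P \<longrightarrow> C = ?blk a \<longrightarrow> g a = h a)"
    if C: "C \<in> ?blk ` P" for C
  proof (cases "a \<in> P \<and> C = ?blk a")
    case True
    then show ?thesis using iso[of a] \<beta>(3) by simp
  next
    case False
    moreover obtain g where "part_iso G c u H d u' J C (\<beta> C) g"
      using bspec[OF \<beta>(2) C] by (elim exE) (rule that)
    ultimately show ?thesis by (intro exI[of _ g]) simp
  qed
  then have "\<forall>C\<in>?blk ` P. \<exists>g. part_iso G c u H d u' J C (\<beta> C) g \<and> (a \<in> P \<longrightarrow> C = ?blk a \<longrightarrow> g a = h a)"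
    by (rule ballI)
  from bchoice[OF this] obtain \<gamma>
    where \<gamma>': "\<forall>C\<in>?blk ` P. part_iso G c u H d u' J C (\<beta> C) (\<gamma> C) \<and> (a \<in> P \<longrightarrow> C = ?blk a \<longrightarrow> \<gamma> C a = h a)"
    by (elim exE) (rule that)
  have \<gamma>: "part_iso G c u H d u' J C (\<beta> C) (\<gamma> C)" if "C \<in> ?blk ` P" for C
    using bspec[OF \<gamma>' that] by (rule conjunct1)
  define g where "g x = \<gamma> (?blk x) x" for x
  have iso_blk: "part_iso G c u H d u' J (?blk x) (\<beta> (?blk x)) (\<gamma> (?blk x))" if "x \<in> P" for x
    by (rule \<gamma>[OF imageI[OF that]])
  have g_in: "g x \<in> \<beta> (?blk x)" if "x \<in> P" for x
    using bij_betwE[OF part_isoD(1)[OF iso_blk[OF that]]] reach_self[of x ?S] by (simp add: g_def)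
  have \<beta>_blk: "\<exists>x'\<in>P'. \<beta> (?blk x) = ?blk' x'" if "x \<in> P" for x
  proof -
    have "\<beta> (?blk x) \<in> ?blk' ` P'" using bij_betw_apply[OF \<beta>(1)] that by simp
    then show ?thesis by auto
  qed
  have blk'_g: "g x \<in> P' \<and> ?blk' (g x) = \<beta> (?blk x)" if x: "x \<in> P" for x
  proof -
    from \<beta>_blk[OF x] obtain x' where x': "x' \<in> P'" "\<beta> (?blk x) = ?blk' x'" by (elim bexE) (rule that)
    have g: "g x \<in> ?blk' x'" using g_in[OF x] x'(2) by simp
    have "?blk' x' \<subseteq> P'" using blk'[OF x'(1)] by simp
    then show ?thesis using g x'(2) blk'_eq[OF g] by auto
  qed
  have same_blk: "?blk x = ?blk y" if "x \<in> P" "y \<in> P" "?blk' (g x) = ?blk' (g y)" for x y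
  proof -
    have "\<beta> (?blk x) = \<beta> (?blk y)" using blk'_g[OF that(1)] blk'_g[OF that(2)] that(3) by simp
    moreover have "inj_on \<beta> (?blk ` P)" using \<beta>(1) by (simp add: bij_betw_def)
    ultimately show ?thesis using that(1,2) by (simp add: inj_on_eq_iff)
  qed
  have inj: "inj_on g P"
  proof
    fix x y assume xy: "x \<in> P" "y \<in> P" "g x = g y"
    then have eq: "?blk x = ?blk y" using same_blk[OF xy(1,2)] by simp
    have "inj_on (\<gamma> (?blk x)) (?blk x)"
      using part_isoD(1)[OF iso_blk[OF xy(1)]] by (simp add: bij_betw_def)
    moreover have "\<gamma> (?blk x) x = \<gamma> (?blk x) y" using xy(3) eq by (simp add: g_def)
    moreover have "x \<in> ?blk x" "y \<in> ?blk x" using reach_self[of x ?S] reach_self[of y ?S] eq by simp_all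
    ultimately show "x = y" by (rule inj_onD)
  qed
  have "g ` P = P'"
  proof
    show "g ` P \<subseteq> P'" by (rule image_subsetI) (simp add: blk'_g)
    show "P' \<subseteq> g ` P"
    proof
      fix x' assume x': "x' \<in> P'"
      then have "?blk' x' \<in> \<beta> ` ?blk ` P" using \<beta>(1) by (simp add: bij_betw_def)
      then obtain x where x: "x \<in> P" "?blk' x' = \<beta> (?blk x)" by blast
      have "x' \<in> \<gamma> (?blk x) ` ?blk x"
        using iso_blk[OF x(1)] x(2) blk'[OF x'] by (simp add: part_iso_def bij_betw_def)
      then obtain y where y: "y \<in> ?blk x" "x' = \<gamma> (?blk x) y" by blast
      have "y \<in> P" using y(1) blk[OF x(1)] by blast
      moreover have "x' = g y" using y(2) blk_eq[OF y(1)] by (simp add: g_def)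
      ultimately show "x' \<in> g ` P" by simp
    qed
  qed
  then have bij: "bij_betw g P P'" using inj by (simp add: bij_betw_def)
  have local: "d (g x) = c x \<and> vertex_type H u' J (g x) = vertex_type G u J x" if "x \<in> P" for x
    using part_isoD(2,3)[OF iso_blk[OF that] reach_self] by (simp add: g_def)
  have edge: "(x, y) \<in> parcs G \<longleftrightarrow> (g x, g y) \<in> parcs H" if xy: "x \<in> P" "y \<in> P" for x y
  proof (cases "?blk x = ?blk y")
    case True
    then show ?thesis
      using part_isoD(4)[OF iso_blk[OF xy(1)] reach_self, of y] reach_self[of y ?S] by (simp add: g_def)
  next
    case False
    then have "\<not> ?S x y" using blk_eq[of y x] reach_step[OF reach_self, of ?S x y] by auto
    moreover have "\<not> ?S' (g x) (g y)"
      using False same_blk[OF xy] blk'_eq[of "g y" "g x"] reach_step[OF reach_self, of ?S' "g x" "g y"] by auto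
    moreover have "g x \<in> pverts H" "g y \<in> pverts H" "x \<in> pverts G" "y \<in> pverts G"
      using xy blk'_g[OF xy(1)] blk'_g[OF xy(2)] P(1) P'(1) by auto
    ultimately show ?thesis using local[OF xy(1)] local[OF xy(2)] by (simp add: flip_adj_def)
  qed
  have "part_iso G c u H d u' J P P' g" unfolding part_iso_def using bij local edge by simp
  moreover have "g a = h a" if "a \<in> P" using bspec[OF \<gamma>' imageI[OF that]] that by (simp add: g_def)
  ultimately show ?thesis by (intro exI[of _ g]) simp
qed

section \<open>Transfer along equivalent tuples\<close>

lemma card_Collect_bij:
  assumes "bij_betw h A B" "\<And>x. x \<in> A \<Longrightarrow> P x \<longleftrightarrow> Q (h x)"
  shows "card {x \<in> A. P x} = card {y \<in> B. Q y}"
proof -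
  have im: "h ` A = B" and inj: "inj_on h A" using assms(1) by (simp_all add: bij_betw_def)
  have "h ` {x \<in> A. P x} = {y \<in> B. Q y}" unfolding im[symmetric] using assms(2) by auto
  moreover have "inj_on h {x \<in> A. P x}" using inj by (auto intro: inj_on_subset)
  ultimately show ?thesis by (metis card_image)
qed

text \<open>A vertex \<open>w\<close> running through a free position \<open>m\<close> keeps its
  adjacency to the entry at \<open>i\<close> and to those at \<open>J\<close> under the exchange
  bijection, so all degrees agree. Besides \<open>J\<close>, this takes the positions
  \<open>i\<close> and \<open>m\<close>.\<close>

lemma vertex_type_transfer:
  assumes G: "finite (pverts G)" "finite (pverts H)" and uu: "wl_equiv l G c H d u u'"
    and J: "J \<subseteq> {..<l}" "card J + 1 < l" and i: "i < l"
  shows "vertex_type H u' J (u' ! i) = vertex_type G u J (u ! i)"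
proof -
  have finJ: "finite J" using J(1) finite_subset by auto
  have nbr: "nbr_type G t J (t ! j) = nbr_type H t' J (t' ! j)" if "wl_equiv l G c H d t t'" "j < l" for t t' j
    using wl_equiv_nth2(2)[OF that(1)] that(2) J(1) by (auto simp: nbr_type_def)
  have "card (insert i J) < l" using J(2) finJ by (simp add: card_insert_if)
  then obtain m where m: "m < l" "m \<notin> insert i J" using fresh_index[of "insert i J"] finJ by blast
  obtain h where h: "bij_betw h (pverts G) (pverts H)"
    "\<And>w. w \<in> pverts G \<Longrightarrow> wl_equiv l G c H d (u[m := w]) (u'[m := h w])"
    using wl_equiv_bij[OF G uu] m(1) by metis
  have len: "length u = l" "length u' = l" using uu by (simp_all add: wl_equiv_def)
  have nbr_w: "nbr_type G u J w = nbr_type H u' J (h w)" if "w \<in> pverts G" for w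
  proof -
    have "nbr_type G u J w = nbr_type G (u[m := w]) J w"
      "nbr_type H u' J (h w) = nbr_type H (u'[m := h w]) J (h w)"
    proof -
      have "j \<noteq> m" if "j \<in> J" for j using that m(2) by blast
      then show "nbr_type G u J w = nbr_type G (u[m := w]) J w"
        "nbr_type H u' J (h w) = nbr_type H (u'[m := h w]) J (h w)"
        unfolding nbr_type_def by (metis (no_types, lifting) nth_list_update_neq)+
    qed
    then show ?thesis using nbr[OF h(2)[OF that] m(1)] m(1) len by simp
  qed
  have adj_w: "(u ! i, w) \<in> parcs G \<longleftrightarrow> (u' ! i, h w) \<in> parcs H" if "w \<in> pverts G" for w
    using wl_equiv_nth2(2)[OF h(2)[OF that] i m(1)] m len by (auto simp: nth_list_update)
  have "card {y \<in> pverts G. (u ! i, y) \<in> parcs G \<and> nbr_type G u J y \<in> \<L>} =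
    card {y \<in> pverts H. (u' ! i, y) \<in> parcs H \<and> nbr_type H u' J y \<in> \<L>}" for \<L>
    by (rule card_Collect_bij[OF h(1)]) (simp add: nbr_w adj_w)
  then show ?thesis using nbr[OF uu i] by (simp add: vertex_type_def fun_eq_iff)
qed

text \<open>The entries of \<open>u\<close> at \<open>J\<close> fix the types, while the other
  entries of \<open>t\<close> may range over arbitrary vertices.\<close>

lemma vertex_type_transfer_agree:
  assumes G: "finite (pverts G)" "finite (pverts H)" and tt: "wl_equiv l G c H d t t'"
    and J: "J \<subseteq> {..<l}" "card J + 1 < l"
    and agree: "\<forall>m\<in>J. t ! m = u ! m \<and> t' ! m = u' ! m" and i: "i < l"
  shows "vertex_type H u' J (t' ! i) = vertex_type G u J (t ! i)"
proof -
  have "vertex_type G u J = vertex_type G t J" "vertex_type H u' J = vertex_type H t' J"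
    by (rule vertex_type_cong; use agree in simp)+
  then show ?thesis using vertex_type_transfer[OF G tt J i] by simp
qed

lemma flip_adj_transfer:
  assumes G: "finite (pverts G)" "finite (pverts H)" and tt: "wl_equiv l G c H d t t'"
    and J: "J \<subseteq> {..<l}" "card J + 1 < l"
    and agree: "\<forall>m\<in>J. t ! m = u ! m \<and> t' ! m = u' ! m" and ij: "i < l" "j < l"
  shows "flip_adj G u J F (t ! i) (t ! j) \<longleftrightarrow> flip_adj H u' J F (t' ! i) (t' ! j)"
  using vertex_type_transfer_agree[OF G tt J agree ij(1)]
    vertex_type_transfer_agree[OF G tt J agree ij(2)]
    wl_equiv_nth[OF tt ij(1)] wl_equiv_nth[OF tt ij(2)] wl_equiv_nth2(2)[OF tt ij]
  by (simp add: flip_adj_def)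

text \<open>Walks of any length are followed with one spare position: the last but one vertex is put
  at \<open>m\<close>, the induction hypothesis handles the walk from \<open>i\<close> to
  \<open>m\<close>, and \<open>R\<close> the step from \<open>m\<close> to \<open>j\<close>. Hence
  three positions besides \<open>J\<close>. The relation is left abstract because a union of two
  flips is needed later.\<close>

lemma reach_transfer:
  assumes G: "finite (pverts G)" "finite (pverts H)" and uu: "wl_equiv l G c H d u u'"
    and J: "finite J" "card J + 2 < l" and ij: "i < l" "j < l"
    and R_vert: "\<And>x y. R x y \<Longrightarrow> x \<in> pverts G"
    and R: "\<And>t t' i j. wl_equiv l G c H d t t' \<Longrightarrow> (\<forall>m\<in>J. t ! m = u ! m \<and> t' ! m = u' ! m) \<Longrightarrow>
      i < l \<Longrightarrow> j < l \<Longrightarrow> R (t ! i) (t ! j) \<Longrightarrow> R' (t' ! i) (t' ! j)"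
    and reach: "u ! j \<in> reach R (u ! i)"
  shows "u' ! j \<in> reach R' (u' ! i)"
proof -
  have "R'\<^sup>*\<^sup>* (t' ! i) (t' ! j)"
    if "R\<^sup>*\<^sup>* x y" "wl_equiv l G c H d t t'" "\<forall>m\<in>J. t ! m = u ! m \<and> t' ! m = u' ! m" "j < l"
      "t ! i = x" "t ! j = y" for x y t t' j
    using that
  proof (induction arbitrary: t t' j rule: rtranclp_induct)
    case base
    then have "t' ! i = t' ! j" using wl_equiv_nth2(1)[OF base(1) ij(1) base(3)] by simp
    then show ?case by simp
  next
    case (step y z)
    have "card (insert i (insert j J)) < l" using J by (simp add: card_insert_if)
    then obtain m where m: "m < l" "m \<notin> insert i (insert j J)"
      using fresh_index[of "insert i (insert j J)"] J(1) by blast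
    obtain h where h: "wl_equiv l G c H d (t[m := y]) (t'[m := h y])"
      using wl_equiv_bij[OF G step.prems(1)] m(1) R_vert[OF step.hyps(2)] by metis
    have len: "length t = l" "length t' = l" using step.prems(1) by (simp_all add: wl_equiv_def)
    have agree: "\<forall>n\<in>J. t[m := y] ! n = u ! n \<and> t'[m := h y] ! n = u' ! n"
      using step.prems(2) m(2) by (metis insertCI nth_list_update_neq)
    have "R'\<^sup>*\<^sup>* (t'[m := h y] ! i) (t'[m := h y] ! m)"
      by (rule step.IH[OF h agree m(1)]) (use m step.prems len in auto)
    moreover have "R' (t'[m := h y] ! m) (t'[m := h y] ! j)"
      by (rule R[OF h agree m(1) step.prems(3)]) (use m step len in auto)
    ultimately show ?case using m len by (auto simp: nth_list_update)
  qed
  then show ?thesis using reach uu ij(2) by (simp add: reach_def)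
qed

lemma flip_reach_transfer:
  assumes G: "finite (pverts G)" "finite (pverts H)" and tt: "wl_equiv l G c H d t t'"
    and J: "J \<subseteq> {..<l}" "card J + 2 < l"
    and agree: "\<forall>m\<in>J. t ! m = u ! m \<and> t' ! m = u' ! m" and ij: "i < l" "j < l"
  shows "t ! j \<in> reach (flip_adj G u J F) (t ! i) \<longleftrightarrow> t' ! j \<in> reach (flip_adj H u' J F) (t' ! i)"
proof -
  have finJ: "finite J" using J(1) finite_subset by auto
  have J1: "card J + 1 < l" using J(2) by simp
  show ?thesis
  proof
    assume reach: "t ! j \<in> reach (flip_adj G u J F) (t ! i)"
    show "t' ! j \<in> reach (flip_adj H u' J F) (t' ! i)"
    proof (rule reach_transfer[OF G tt finJ J(2) ij _ _ reach])
      fix s s' i j assume s: "wl_equiv l G c H d s s'" "\<forall>m\<in>J. s ! m = t ! m \<and> s' ! m = t' ! m"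
        "i < l" "j < l" "flip_adj G u J F (s ! i) (s ! j)"
      have "\<forall>m\<in>J. s ! m = u ! m \<and> s' ! m = u' ! m" using s(2) agree by simp
      then show "flip_adj H u' J F (s' ! i) (s' ! j)"
        using flip_adj_transfer[OF G s(1) J(1) J1 _ s(3,4)] s(5) by blast
    qed (simp add: flip_adj_def)
  next
    assume reach: "t' ! j \<in> reach (flip_adj H u' J F) (t' ! i)"
    show "t ! j \<in> reach (flip_adj G u J F) (t ! i)"
    proof (rule reach_transfer[OF G(2,1) wl_equiv_sym[OF tt] finJ J(2) ij _ _ reach])
      fix s s' i j assume s: "wl_equiv l H d G c s s'" "\<forall>m\<in>J. s ! m = t' ! m \<and> s' ! m = t ! m"
        "i < l" "j < l" "flip_adj H u' J F (s ! i) (s ! j)"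
      have "\<forall>m\<in>J. s ! m = u' ! m \<and> s' ! m = u ! m" using s(2) agree by simp
      then show "flip_adj G u J F (s' ! i) (s' ! j)"
        using flip_adj_transfer[OF G(2,1) s(1) J(1) J1 _ s(3,4)] s(5) by blast
    qed (simp add: flip_adj_def)
  qed
qed

text \<open>
  Inside \<open>Y\<close> the components with respect to the coarse types of the index set \<open>I\<close> and those with
  respect to the finer types of \<open>J\<close> coincide, and an isomorphism that preserves the coarse types
  preserves the fine ones: adjacency to the vertices outside \<open>Y\<close> is determined by the coarse type,
  and degrees split into a part inside the component and a part determined by the flip.
\<close>

lemma part_iso_refine:
  assumes sym: "sym (parcs G)"
    and fin: "finite (pverts G)" "finite (pverts H)" and tt: "wl_equiv l G c H d t t'"
    and J: "J \<subseteq> {..<l}" "card J + 2 < l" and I: "I \<subseteq> J" and q: "q < l"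
    and Y: "t ! q \<in> Y" "Y \<subseteq> pverts G"
    and sp: "split_pair G Y A B" "A \<union> B \<subseteq> (!) t ` I" "(!) t ` J \<subseteq> A \<union> (pverts G - Y)"
    and sep: "flip_separates G t I Y F"
    and F': "\<And>x y. x \<in> Y \<Longrightarrow> y \<in> pverts G \<Longrightarrow> F' (vertex_type G t J x) (vertex_type G t J y) =
       F (vertex_type G t I x) (vertex_type G t I y)"
    and iso: "part_iso G c t H d t' I (reach (flip_adj G t I F) (t ! q)) (reach (flip_adj H t' I F) (t' ! q)) g"
  shows "part_iso G c t H d t' J (reach (flip_adj G t J F') (t ! q)) (reach (flip_adj H t' J F') (t' ! q)) g"
proof -
  let ?S = "flip_adj G t I F" and ?S' = "flip_adj H t' I F"
  let ?R = "flip_adj G t J F'" and ?R' = "flip_adj H t' J F'"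
  let ?C = "reach ?S (t ! q)" and ?C' = "reach ?S' (t' ! q)"
  have finJ: "finite J" using J(1) finite_subset by auto
  have closed: "z \<in> Y" if "y \<in> Y" "?S y z" for y z
    using that sep unfolding flip_separates_def flip_adj_def by blast
  have CY: "?C \<subseteq> Y" by (rule reach_subset[OF Y(1) closed])
  have RS: "?R y z \<longleftrightarrow> ?S y z" if "y \<in> Y" for y z
    using F'[OF that, of z] unfolding flip_adj_def by auto
  have C_eq: "reach ?S (t ! q) = reach ?R (t ! q)"
    by (rule reach_mono_on[OF Y(1) closed]) (simp_all add: RS)
  have "card (insert q J) < l" using J(2) finJ by (simp add: card_insert_if)
  then obtain m where m: "m < l" "m \<notin> insert q J" using fresh_index[of "insert q J"] finJ by blast
  obtain h where h: "bij_betw h (pverts G) (pverts H)"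
    "\<And>w. w \<in> pverts G \<Longrightarrow> wl_equiv l G c H d (t[m := w]) (t'[m := h w])"
    using wl_equiv_bij[OF fin tt] m(1) by metis
  have len: "length t = l" "length t' = l" using tt by (simp_all add: wl_equiv_def)
  have agree: "\<forall>n\<in>J. t[m := w] ! n = t ! n \<and> t'[m := h w] ! n = t' ! n" for w
    using m(2) by (metis insertCI nth_list_update_neq)
  have J1: "card J + 1 < l" using J(2) by simp
  have type_h: "vertex_type H t' J (h w) = vertex_type G t J w" if "w \<in> pverts G" for w
    using vertex_type_transfer_agree[OF fin h(2)[OF that] J(1) J1 agree m(1)] m(1) len by simp
  have type_hI: "vertex_type H t' I (h w) = vertex_type G t I w" if "w \<in> pverts G" for w
    unfolding vertex_type_restrict[OF I] type_h[OF that] ..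
  have reach_h: "w \<in> ?C \<longleftrightarrow> h w \<in> reach ?R' (t' ! q)" if "w \<in> pverts G" for w
    unfolding C_eq
    using flip_reach_transfer[OF fin h(2)[OF that] J agree q m(1), of F'] m len by auto
  have surj: "\<exists>y\<in>pverts G. y' = h y" if "y' \<in> pverts H" for y'
    using h(1) that by (auto simp: bij_betw_def)
  \<comment> \<open>\<open>H\<close> has no counterpart of \<open>Y\<close> at hand; the vertices
    are pulled back along \<open>h\<close>, which preserves both kinds of types, to the component
    inside \<open>Y\<close>.\<close>
  have C'_eq: "reach ?R' (t' ! q) = ?C'"
  proof (rule reach_mono_on[OF reach_self])
    show "z \<in> reach ?R' (t' ! q)" if "y \<in> reach ?R' (t' ! q)" "?R' y z" for y z
      by (rule reach_step[OF that])
    show "?R' y' z' \<longleftrightarrow> ?S' y' z'" if y': "y' \<in> reach ?R' (t' ! q)" for y' z'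
    proof (cases "z' \<in> pverts H")
      case True
      have "reach ?R' (t' ! q) \<subseteq> pverts H"
        by (rule reach_subset) (use wl_equiv_nth(2)[OF tt q] in \<open>simp_all add: flip_adj_def\<close>)
      then obtain y where y: "y \<in> pverts G" "y' = h y" using surj y' by blast
      obtain z where z: "z \<in> pverts G" "z' = h z" using surj[OF True] by blast
      have "y \<in> Y" using reach_h[OF y(1)] y' y(2) CY by auto
      then show ?thesis
        using F'[of y z] type_h[OF y(1)] type_h[OF z(1)] type_hI[OF y(1)] type_hI[OF z(1)] y z
        by (simp add: flip_adj_def)
    qed (simp add: flip_adj_def)
  qed
  have reach_h': "w \<in> ?C \<longleftrightarrow> h w \<in> ?C'" if "w \<in> pverts G" for w
    using reach_h[OF that] C'_eq by simp
  have g_bij: "bij_betw g ?C ?C'" by (rule part_isoD(1)[OF iso])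
  have CG: "?C \<subseteq> pverts G" using CY Y(2) by simp
  have C'H: "?C' \<subseteq> pverts H"
    by (rule reach_subset) (use wl_equiv_nth(2)[OF tt q] in \<open>simp_all add: flip_adj_def\<close>)
  have nbr_g: "nbr_type H t' J (g x) = nbr_type G t J x" if x: "x \<in> ?C" for x
  proof -
    \<comment> \<open>The vertex \<open>x0\<close> with \<open>h x0 = g x\<close> has the right fine
      type, and it has the coarse type of \<open>x\<close>. Both lie in \<open>Y\<close>, so they
      have the same adjacency to \<open>A\<close> and to everything outside \<open>Y\<close>, which
      covers the entries at \<open>J\<close>.\<close>
    have gx: "g x \<in> ?C'" using bij_betwE[OF g_bij] x by simp
    then obtain x0 where x0: "x0 \<in> pverts G" "g x = h x0" using surj C'H by blast
    have "x0 \<in> ?C" using reach_h'[OF x0(1)] gx x0(2) by simp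
    then have xY: "x \<in> Y" "x0 \<in> Y" using x CY by auto
    have "vertex_type G t I x = vertex_type G t I x0"
      using part_isoD(3)[OF iso x] type_hI[OF x0(1)] x0(2) by simp
    note adj = nbr_type_eq_adj[OF vertex_type_eq_nbr[OF this]]
    have "(x, b) \<in> parcs G \<longleftrightarrow> (x0, b) \<in> parcs G" if "b \<in> pverts G - Y" for b
      by (rule split_pair_row_eq[OF sp(1) xY _ that]) (use sp(2) in \<open>auto intro!: adj\<close>)
    then have "(x, t ! j) \<in> parcs G \<longleftrightarrow> (x0, t ! j) \<in> parcs G" if "j \<in> J" for j
      using sp(2,3) adj that by blast
    then have "nbr_type G t J x = nbr_type G t J x0" unfolding nbr_type_def by blast
    also have "\<dots> = nbr_type H t' J (g x)" using vertex_type_eq_nbr[OF type_h[OF x0(1)]] x0(2) by simp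
    finally show ?thesis by simp
  qed
  \<comment> \<open>A hybrid bijection to compare degrees: \<open>g\<close> is correct inside the
    component, \<open>h\<close> outside, where adjacency to the component depends on types
    only.\<close>
  define k where "k y = (if y \<in> ?C then g y else h y)" for y
  have im_h: "h ` (pverts G - ?C) = pverts H - ?C'"
  proof
    show "h ` (pverts G - ?C) \<subseteq> pverts H - ?C'"
      using reach_h' bij_betwE[OF h(1)] by blast
    show "pverts H - ?C' \<subseteq> h ` (pverts G - ?C)"
      using reach_h' surj by blast
  qed
  have "bij_betw k ?C ?C'" using g_bij by (subst bij_betw_cong[of _ _ g]) (simp_all add: k_def)
  moreover have "bij_betw k (pverts G - ?C) (pverts H - ?C')"
    using h(1) im_h
    by (subst bij_betw_cong[of _ _ h]) (auto simp: k_def bij_betw_def intro: inj_on_subset)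
  ultimately have "bij_betw k (?C \<union> (pverts G - ?C)) (?C' \<union> (pverts H - ?C'))"
    by (rule bij_betw_combine) blast
  then have k_bij: "bij_betw k (pverts G) (pverts H)" using CG C'H by (simp add: Un_absorb1)
  have k_nbr: "nbr_type H t' J (k y) = nbr_type G t J y" if "y \<in> pverts G" for y
    using nbr_g vertex_type_eq_nbr[OF type_h[OF that]] by (simp add: k_def)
  have k_adj: "(x, y) \<in> parcs G \<longleftrightarrow> (g x, k y) \<in> parcs H" if x: "x \<in> ?C" and y: "y \<in> pverts G" for x y
  proof (cases "y \<in> ?C")
    case True
    then show ?thesis using part_isoD(4)[OF iso x True] by (simp add: k_def)
  next
    case False
    have gx: "g x \<in> ?C'" using bij_betwE[OF g_bij] x by simp
    have "\<not> ?S x y" using False reach_step[OF x] by blast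
    moreover have "\<not> ?S' (g x) (h y)" using False reach_step[OF gx] reach_h'[OF y] by blast
    moreover have "x \<in> pverts G" "g x \<in> pverts H" "h y \<in> pverts H"
      using x gx CG C'H bij_betwE[OF h(1)] y by auto
    ultimately show ?thesis
      using False y part_isoD(3)[OF iso x] type_hI[OF y] by (simp add: flip_adj_def k_def)
  qed
  have "vertex_type H t' J (g x) = vertex_type G t J x" if x: "x \<in> ?C" for x
  proof -
    have "card {y \<in> pverts G. (x, y) \<in> parcs G \<and> nbr_type G t J y \<in> \<L>} =
      card {y \<in> pverts H. (g x, y) \<in> parcs H \<and> nbr_type H t' J y \<in> \<L>}" for \<L>
      by (rule card_Collect_bij[OF k_bij]) (simp add: k_adj[OF x] k_nbr)
    then show ?thesis using nbr_g[OF x] by (simp add: vertex_type_def)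
  qed
  then show ?thesis
    unfolding C_eq[symmetric] C'_eq using iso unfolding part_iso_def by simp
qed

section \<open>Induction along the rank decomposition\<close>

lemma flip_adj_cong: "\<forall>j\<in>J. u ! j = t ! j \<Longrightarrow> flip_adj G u J F = flip_adj G t J F"
  using vertex_type_cong[of J u t G] by (simp add: flip_adj_def fun_eq_iff)

lemma part_iso_cong:
  "\<forall>j\<in>J. u ! j = t ! j \<Longrightarrow> \<forall>j\<in>J. u' ! j = t' ! j \<Longrightarrow>
    part_iso G c u H d u' J = part_iso G c t H d t' J"
  using vertex_type_cong[of J u t G] vertex_type_cong[of J u' t' H] by (simp add: part_iso_def fun_eq_iff)

lemma flip_separates_cong:
  "\<forall>j\<in>J. u ! j = t ! j \<Longrightarrow> flip_separates G u J X F = flip_separates G t J X F"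
  using vertex_type_cong[of J u t G] by (simp add: flip_separates_def)

lemma flip_separates_closed:
  "flip_separates G u J X F \<Longrightarrow> x \<in> X \<Longrightarrow> flip_adj G u J F x y \<Longrightarrow> y \<in> X"
  unfolding flip_separates_def flip_adj_def by blast

text \<open>The base case. A second vertex in the component of \<open>H\<close> would be the image
  under an exchange bijection of a second vertex in the component of \<open>G\<close>.\<close>

lemma part_iso_singleton:
  assumes fin: "finite (pverts G)" "finite (pverts H)" and uu: "wl_equiv l G c H d u u'"
    and I: "I \<subseteq> {..<l}" "card I + 2 < l" and p: "p < l"
    and C: "reach (flip_adj G u I F) (u ! p) = {u ! p}"
  shows "part_iso G c u H d u' I (reach (flip_adj G u I F) (u ! p))
    (reach (flip_adj H u' I F) (u' ! p)) (\<lambda>_. u' ! p)"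
proof -
  let ?C' = "reach (flip_adj H u' I F) (u' ! p)"
  have finI: "finite I" using I(1) finite_subset by auto
  have "?C' \<subseteq> {u' ! p}"
  proof
    fix y' assume y': "y' \<in> ?C'"
    have "?C' \<subseteq> pverts H"
      by (rule reach_subset) (use wl_equiv_nth(2)[OF uu p] in \<open>simp_all add: flip_adj_def\<close>)
    have "card (insert p I) < l" using I(2) finI by (simp add: card_insert_if)
    then obtain m where m: "m < l" "m \<notin> insert p I" using fresh_index[of "insert p I"] finI by blast
    obtain h where h: "bij_betw h (pverts G) (pverts H)"
      "\<And>w. w \<in> pverts G \<Longrightarrow> wl_equiv l G c H d (u[m := w]) (u'[m := h w])"
      using wl_equiv_bij[OF fin uu] m(1) by metis
    have len: "length u = l" "length u' = l" using uu by (simp_all add: wl_equiv_def)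
    obtain y where y: "y \<in> pverts G" "y' = h y"
      using h(1) y' \<open>?C' \<subseteq> pverts H\<close> by (auto simp: bij_betw_def)
    have agree: "\<forall>n\<in>I. u[m := y] ! n = u ! n \<and> u'[m := h y] ! n = u' ! n"
      using m(2) by (metis insertCI nth_list_update_neq)
    have "y \<in> reach (flip_adj G u I F) (u ! p)"
      using flip_reach_transfer[OF fin h(2)[OF y(1)] I agree p m(1), of F] m len y(2) y' by auto
    then have "y = u ! p" using C by simp
    then have "h y = u' ! p" using wl_equiv_nth2(1)[OF h(2)[OF y(1)] m(1) p] m len by auto
    then show "y' \<in> {u' ! p}" using y(2) by simp
  qed
  then have C': "?C' = {u' ! p}" using reach_self by fast
  have I1: "card I + 1 < l" using I(2) by simp
  show ?thesis
    unfolding C C' part_iso_def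
    using vertex_type_transfer[OF fin uu I(1) I1 p] wl_equiv_nth(3)[OF uu p] wl_equiv_nth2(2)[OF uu p p]
    by (simp add: bij_betw_def)
qed

text \<open>The position \<open>p\<close> marks the component and is not part of \<open>I\<close>,
  so the marked vertex can vary while the types stay fixed. All other positions are free, and
  injectivity on \<open>I\<close> bounds how many are occupied.\<close>

lemma component_iso:
  assumes sym: "sym (parcs G)" "sym (parcs H)" and fin: "finite (pverts G)" "finite (pverts H)"
    and l: "3 * k + 4 \<le> l"
    and "decomposes T" "root_label T \<subseteq> pverts G" "\<forall>Z\<in>labels T. cut_rank G Z \<le> k"
    and "wl_equiv l G c H d u u'" "I \<subseteq> {..<l}" "inj_on ((!) u) I" "p < l" "p \<notin> I"
    and "split_pair G (root_label T) A B" "(!) u ` I = A \<union> B" "card A \<le> k" "card B \<le> k"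
    and "flip_separates G u I (root_label T) F" "u ! p \<in> root_label T"
  shows "\<exists>g. part_iso G c u H d u' I (reach (flip_adj G u I F) (u ! p))
    (reach (flip_adj H u' I F) (u' ! p)) g \<and> g (u ! p) = u' ! p"
  using assms(6-)
proof (induction T arbitrary: u u' I p A B F)
  case (Leaf X)
  have "card I = card (A \<union> B)" using card_image[OF Leaf.prems(6)] Leaf.prems(10) by simp
  then have cardI: "card I + 2 < l" using card_Un_le[of A B] Leaf.prems(11,12) l by linarith
  have "X = {u ! p}" using Leaf.prems(1,14) by (auto simp: card_1_singleton_iff)
  then have "reach (flip_adj G u I F) (u ! p) \<subseteq> {u ! p}"
    using reach_subset[OF Leaf.prems(14) flip_separates_closed[OF Leaf.prems(13)]] by simp
  then have "reach (flip_adj G u I F) (u ! p) = {u ! p}" using reach_self by fast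
  from part_iso_singleton[OF fin Leaf.prems(4,5) cardI Leaf.prems(7) this]
  show ?case by (intro exI conjI) auto
next
  case (Node X s1 s2)
  let ?V = "pverts G"
  define X1 X2 where "X1 = root_label s1" and "X2 = root_label s2"
  have X: "X = X1 \<union> X2" "X1 \<inter> X2 = {}" "X \<subseteq> ?V" and dec: "decomposes s1" "decomposes s2"
    using Node.prems(1,2) by (simp_all add: X1_def X2_def)
  have XV: "X1 \<subseteq> ?V" "X2 \<subseteq> ?V" using X by auto
  have rank: "\<forall>Z\<in>labels s1. cut_rank G Z \<le> k" "\<forall>Z\<in>labels s2. cut_rank G Z \<le> k"
    using Node.prems(3) by auto
  have rank': "cut_rank G X1 \<le> k" "cut_rank G X2 \<le> k"
    using rank bintree.set_intros(1) by (metis X1_def X2_def bintree.collapse(1) bintree.collapse(2) bintree.set_intros(2))+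
  note uu = Node.prems(4) and I = Node.prems(5) and injI = Node.prems(6) and p = Node.prems(7,8)
  have sp: "split_pair G X A B" and sep: "flip_separates G u I X F" and up: "u ! p \<in> X"
    using Node.prems(9,13,14) by simp_all
  obtain A1 A2 B1 B2 where sp1: "split_pair G X1 A1 B1" and sp2: "split_pair G X2 A2 B2"
    and AB: "A \<subseteq> A1 \<union> A2" "B1 \<subseteq> B \<union> A2" "B2 \<subseteq> B \<union> A1"
    and card': "card A1 \<le> cut_rank G X1" "card B1 \<le> cut_rank G X1"
      "card A2 \<le> cut_rank G X2" "card B2 \<le> cut_rank G X2"
    by (rule split_pair_children[OF sym(1) fin(1) X sp])
  have card: "card A1 \<le> k" "card B1 \<le> k" "card A2 \<le> k" "card B2 \<le> k"
    using card' rank' by linarith+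
  have AB_V: "A \<subseteq> X" "B \<subseteq> ?V - X" "A1 \<subseteq> X1" "A2 \<subseteq> X2"
    using split_pair_subsets[OF sp] split_pair_subsets[OF sp1] split_pair_subsets[OF sp2] by simp_all
  \<comment> \<open>\<open>A\<close> and \<open>B\<close> are already in the tuple, so only these
    vertices are added. They lie in \<open>X\<close> and are thus disjoint from
    \<open>B\<close>.\<close>
  define W where "W = A1 \<union> A2 - A"
  have ZV: "A1 \<union> A2 \<union> B \<subseteq> ?V" using AB_V X by blast
  then have finZ: "finite (A1 \<union> A2 \<union> B)" by (rule finite_subset[OF _ fin(1)])
  have finI: "finite I" using I finite_subset by auto
  have Z_eq: "(A \<union> B) \<union> W = A1 \<union> A2 \<union> B" "(A \<union> B) \<inter> W = {}"
    using AB AB_V X by (auto simp: W_def)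
  have cardZ: "card (A1 \<union> A2 \<union> B) \<le> 3 * k"
    using card_Un_le[of "A1 \<union> A2" B] card_Un_le[of A1 A2] card Node.prems(12) by linarith
  have cardI: "card I = card (A \<union> B)" using card_image[OF injI] Node.prems(10) by simp
  have finW: "finite W" "W \<subseteq> ?V" using finZ ZV by (auto simp: W_def)
  have finAB: "finite (A \<union> B)" using finZ Z_eq(1) by (metis finite_Un)
  have cardW: "card I + card W = card (A1 \<union> A2 \<union> B)"
    unfolding cardI Z_eq(1)[symmetric] by (rule card_Un_disjoint[OF finAB finW(1) Z_eq(2), symmetric])
  have K: "insert p I \<subseteq> {..<l}" "card (insert p I) + card W \<le> l"
    using I p finI cardW cardZ l by auto
  obtain t t' J0 where tt: "wl_equiv l G c H d t t'"
    and agree0: "\<forall>j\<in>insert p I. t ! j = u ! j \<and> t' ! j = u' ! j"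
    and J0: "J0 \<subseteq> {..<l}" "J0 \<inter> insert p I = {}" "bij_betw ((!) t) J0 W"
    using wl_equiv_add_entries[OF fin uu finW K] by (elim exE conjE) (rule that)
  have agree_u: "\<forall>j\<in>I. u ! j = t ! j" "\<forall>j\<in>I. u' ! j = t' ! j" and tp: "t ! p = u ! p" "t' ! p = u' ! p"
    using agree0 by simp_all
  define J where "J = I \<union> J0"
  have J: "J \<subseteq> {..<l}" "I \<subseteq> J" "p \<notin> J" using I J0 p by (auto simp: J_def)
  have finJ: "finite J" using J(1) finite_subset by auto
  have "bij_betw ((!) t) I (A \<union> B)"
    using injI Node.prems(10) agree_u(1)
    by (subst bij_betw_cong[of _ _ "(!) u"]) (simp_all add: bij_betw_def)
  from bij_betw_combine[OF this J0(3) Z_eq(2)]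
  have bijJ: "bij_betw ((!) t) J (A1 \<union> A2 \<union> B)" unfolding Z_eq(1) J_def .
  have imJ: "(!) t ` J = A1 \<union> A2 \<union> B" and injJ: "inj_on ((!) t) J"
    using bijJ by (simp_all add: bij_betw_def)
  have "card J \<le> 3 * k" using bij_betw_same_card[OF bijJ] cardZ by simp
  then have cardJ: "card J + 2 < l" using l by linarith
  have index_set: "\<exists>I'\<subseteq>J. (!) t ` I' = S" if "S \<subseteq> A1 \<union> A2 \<union> B" for S
    using that unfolding imJ[symmetric] by (simp add: subset_image_iff) metis
  obtain I1 where I1: "I1 \<subseteq> J" "(!) t ` I1 = A1 \<union> B1" using index_set[of "A1 \<union> B1"] AB by blast
  obtain I2 where I2: "I2 \<subseteq> J" "(!) t ` I2 = A2 \<union> B2" using index_set[of "A2 \<union> B2"] AB by blast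
  obtain F1 where F1: "flip_separates G t I1 X1 F1"
    using exists_separating_flip[OF sym(1) fin(1) XV(1) sp1, of t I1] I1(2) by auto
  obtain F2 where F2: "flip_separates G t I2 X2 F2"
    using exists_separating_flip[OF sym(1) fin(1) XV(2) sp2, of t I2] I2(2) by auto
  have sep_t: "flip_separates G t I X F" using sep flip_separates_cong[OF agree_u(1)] by simp
  obtain F' where F'_sym: "\<And>P Q. F' P Q = F' Q P"
    and F'1: "\<And>x y. x \<in> X1 \<Longrightarrow> y \<in> ?V \<Longrightarrow> F' (vertex_type G t J x) (vertex_type G t J y) =
       F1 (vertex_type G t I1 x) (vertex_type G t I1 y)"
    and F'2: "\<And>x y. x \<in> X2 \<Longrightarrow> y \<in> ?V \<Longrightarrow> F' (vertex_type G t J x) (vertex_type G t J y) =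
       F2 (vertex_type G t I2 x) (vertex_type G t I2 y)"
  proof (rule exists_common_flip[OF sym(1) X I1(1) I2(1) J(2) F1 F2 sep_t], goal_cases)
    case (1 F')
    show ?case by (rule 1(1)[OF 1(2-4)])
  qed
  let ?S = "flip_adj G t I F" and ?S' = "flip_adj H t' I F"
  let ?R = "flip_adj G t J F'" and ?R' = "flip_adj H t' J F'"
  \<comment> \<open>Closing under the parent's flip and the common flip of the children makes
    \<open>P\<close> both a union of components for the children and a superset of the component for
    the parent.\<close>
  let ?U = "\<lambda>x y. ?S x y \<or> ?R x y" and ?U' = "\<lambda>x y. ?S' x y \<or> ?R' x y"
  define P P' where "P = reach ?U (t ! p)" and "P' = reach ?U' (t' ! p)"
  \<comment> \<open>Hence each vertex of \<open>P\<close> lies in one of the children, where an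
    induction hypothesis applies.\<close>
  have closedX: "y \<in> X" if x: "x \<in> X" and xy: "?U x y" for x y
  proof (cases "?S x y")
    case True
    then show ?thesis using flip_separates_closed[OF sep_t x] by simp
  next
    case False
    then have R: "?R x y" using xy by simp
    then have y: "y \<in> ?V" by (simp add: flip_adj_def)
    consider "x \<in> X1" | "x \<in> X2" using x X(1) by blast
    then show ?thesis
    proof cases
      case 1
      then have "flip_adj G t I1 F1 x y" using R F'1[OF 1 y] by (simp add: flip_adj_def)
      then show ?thesis using flip_separates_closed[OF F1 1] X(1) by simp
    next
      case 2
      then have "flip_adj G t I2 F2 x y" using R F'2[OF 2 y] by (simp add: flip_adj_def)
      then show ?thesis using flip_separates_closed[OF F2 2] X(1) by simp
    qed
  qed
  have PX: "P \<subseteq> X" unfolding P_def by (rule reach_subset) (use up tp closedX in simp_all)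
  have PV: "P \<subseteq> ?V" using PX X(3) by simp
  have P'V: "P' \<subseteq> pverts H"
    unfolding P'_def by (rule reach_subset) (use wl_equiv_nth(2)[OF tt p(1)] in \<open>auto simp: flip_adj_def\<close>)
  have "card (insert p J) < l" using cardJ finJ by (simp add: card_insert_if)
  then obtain q where q: "q < l" "q \<notin> insert p J" using fresh_index[of "insert p J"] finJ by blast
  obtain h where h: "bij_betw h ?V (pverts H)"
    "\<And>w. w \<in> ?V \<Longrightarrow> wl_equiv l G c H d (t[q := w]) (t'[q := h w])"
    using wl_equiv_bij[OF fin tt] q(1) by metis
  have len: "length t = l" "length t' = l" using tt by (simp_all add: wl_equiv_def)
  have agree: "\<forall>n\<in>J. t[q := w] ! n = t ! n \<and> t'[q := h w] ! n = t' ! n" for w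
    using q(2) by (metis insertCI nth_list_update_neq)
  have cardI2: "card I + 1 < l" and cardJ2: "card J + 1 < l"
    using card_mono[OF finJ J(2)] cardJ by linarith+
  have hP: "w \<in> P \<longleftrightarrow> h w \<in> P'" if w: "w \<in> ?V" for w
  proof -
    let ?s = "t[q := w]" and ?s' = "t'[q := h w]"
    have *: "?s ! p = t ! p" "?s' ! p = t' ! p" "?s ! q = w" "?s' ! q = h w"
      using q len by auto
    have adj: "?U (s ! i) (s ! j) \<longleftrightarrow> ?U' (s' ! i) (s' ! j)"
      if s: "wl_equiv l G c H d s s'" "\<forall>m\<in>J. s ! m = t ! m \<and> s' ! m = t' ! m" "i < l" "j < l" for s s' i j
    proof -
      have "\<forall>m\<in>I. s ! m = t ! m \<and> s' ! m = t' ! m" using s(2) J(2) by blast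
      moreover have "I \<subseteq> {..<l}" using J by blast
      ultimately show ?thesis
        using flip_adj_transfer[OF fin s(1) _ cardI2 _ s(3,4), of t t' F]
          flip_adj_transfer[OF fin s(1) J(1) cardJ2 s(2-4), of F'] by blast
    qed
    show ?thesis
    proof
      assume "w \<in> P"
      then have r: "?s ! q \<in> reach ?U (?s ! p)" by (simp add: * P_def)
      have "?s' ! q \<in> reach ?U' (?s' ! p)"
      proof (rule reach_transfer[OF fin h(2)[OF w] finJ cardJ p(1) q(1) _ _ r])
        show "x \<in> ?V" if "?U x y" for x y using that by (auto simp: flip_adj_def)
        show "?U' (s' ! i) (s' ! j)"
          if "wl_equiv l G c H d s s'" "\<forall>m\<in>J. s ! m = ?s ! m \<and> s' ! m = ?s' ! m" "i < l" "j < l"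
            "?U (s ! i) (s ! j)" for s s' i j
          using adj[of s s' i j] that agree[of w] by simp
      qed
      then show "h w \<in> P'" by (simp add: * P'_def)
    next
      assume "h w \<in> P'"
      then have r: "?s' ! q \<in> reach ?U' (?s' ! p)" by (simp add: * P'_def)
      have "?s ! q \<in> reach ?U (?s ! p)"
      proof (rule reach_transfer[OF fin(2,1) wl_equiv_sym[OF h(2)[OF w]] finJ cardJ p(1) q(1) _ _ r])
        show "x \<in> pverts H" if "?U' x y" for x y using that by (auto simp: flip_adj_def)
        show "?U (s' ! i) (s' ! j)"
          if "wl_equiv l H d G c s s'" "\<forall>m\<in>J. s ! m = ?s' ! m \<and> s' ! m = ?s ! m" "i < l" "j < l"
            "?U' (s ! i) (s ! j)" for s s' i j
          using adj[of s' s i j, OF wl_equiv_sym[OF that(1)]] that(2-) agree[of w] by simp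
      qed
      then show "w \<in> P" by (simp add: * P_def)
    qed
  qed
  have "h ` P = P'"
  proof
    show "h ` P \<subseteq> P'"
    proof (rule image_subsetI)
      fix x assume "x \<in> P"
      then show "h x \<in> P'" using hP[of x] PV by auto
    qed
    show "P' \<subseteq> h ` P"
    proof
      fix y assume y: "y \<in> P'"
      then have "y \<in> h ` ?V" using P'V h(1) by (auto simp: bij_betw_def)
      then obtain x where x: "x \<in> ?V" "y = h x" by (elim imageE) (rule that)
      then show "y \<in> h ` P" using hP[OF x(1)] y by simp
    qed
  qed
  then have h_bij: "bij_betw h P P'"
    using h(1) PV by (auto simp: bij_betw_def intro: inj_on_subset)
  \<comment> \<open>Stated for either child: \<open>w\<close> is put at \<open>q\<close>, which
    becomes the marked position for the induction hypothesis, and the resulting isomorphism is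
    refined from the child's index set to \<open>J\<close>.\<close>
  have comp: "\<exists>g. part_iso G c t H d t' J (reach ?R w) (reach ?R' (h w)) g \<and> g w = h w"
    if Y: "w \<in> Y" "Y \<subseteq> ?V" and I': "I' \<subseteq> J" "(!) t ` I' = A' \<union> B'" and sp': "split_pair G Y A' B'"
      and JY: "(!) t ` J \<subseteq> A' \<union> (?V - Y)" and sep': "flip_separates G t I' Y F''"
      and F'': "\<And>x y. x \<in> Y \<Longrightarrow> y \<in> ?V \<Longrightarrow> F' (vertex_type G t J x) (vertex_type G t J y) =
       F'' (vertex_type G t I' x) (vertex_type G t I' y)"
      and IH: "\<And>s s'. wl_equiv l G c H d s s' \<Longrightarrow> inj_on ((!) s) I' \<Longrightarrow> (!) s ` I' = A' \<union> B' \<Longrightarrow>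
        flip_separates G s I' Y F'' \<Longrightarrow> s ! q \<in> Y \<Longrightarrow>
        \<exists>g. part_iso G c s H d s' I' (reach (flip_adj G s I' F'') (s ! q))
          (reach (flip_adj H s' I' F'') (s' ! q)) g \<and> g (s ! q) = s' ! q"
    for w Y I' A' B' F''
  proof -
    let ?s = "t[q := w]" and ?s' = "t'[q := h w]"
    have s: "wl_equiv l G c H d ?s ?s'" using h(2) Y by blast
    have eqJ: "\<forall>j\<in>J. ?s ! j = t ! j" "\<forall>j\<in>J. ?s' ! j = t' ! j" using agree by simp_all
    then have eqI': "\<forall>j\<in>I'. ?s ! j = t ! j" using I'(1) by blast
    have sq: "?s ! q = w" "?s' ! q = h w" using q len by simp_all
    have imI': "(!) ?s ` I' = A' \<union> B'" using eqI' I'(2) by (simp add: image_def)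
    have imJ': "(!) ?s ` J \<subseteq> A' \<union> (?V - Y)" using eqJ JY by (simp add: image_def)
    have "inj_on ((!) t) I'" by (rule inj_on_subset[OF injJ I'(1)])
    then have inj': "inj_on ((!) ?s) I'" using eqI' by (simp add: inj_on_def)
    have sep_s: "flip_separates G ?s I' Y F''" using sep' flip_separates_cong[OF eqI'] by simp
    have sqY: "?s ! q \<in> Y" using Y sq by simp
    obtain g where g: "part_iso G c ?s H d ?s' I' (reach (flip_adj G ?s I' F'') (?s ! q))
          (reach (flip_adj H ?s' I' F'') (?s' ! q)) g" "g (?s ! q) = ?s' ! q"
      using IH[OF s inj' imI' sep_s sqY] by (elim exE conjE) (rule that)
    have "F' (vertex_type G ?s J x) (vertex_type G ?s J y) = F'' (vertex_type G ?s I' x) (vertex_type G ?s I' y)"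
      if "x \<in> Y" "y \<in> ?V" for x y
      using F''[OF that] vertex_type_cong[of J ?s t G] vertex_type_cong[of I' ?s t G] eqJ eqI' by simp
    from part_iso_refine[OF sym(1) fin s J(1) cardJ I'(1) q(1) sqY Y(2) sp' _ imJ' sep_s this g(1)] imI'
    have "part_iso G c ?s H d ?s' J (reach (flip_adj G ?s J F') (?s ! q))
      (reach (flip_adj H ?s' J F') (?s' ! q)) g" by simp
    then have "part_iso G c t H d t' J (reach ?R w) (reach ?R' (h w)) g"
      unfolding sq flip_adj_cong[OF eqJ(1)] flip_adj_cong[OF eqJ(2)] part_iso_cong[OF eqJ] .
    then show ?thesis using g(2) sq by auto
  qed
  have JY: "(!) t ` J \<subseteq> A1 \<union> (?V - X1)" "(!) t ` J \<subseteq> A2 \<union> (?V - X2)"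
    unfolding imJ using AB_V X by blast+
  have q': "q \<notin> I1" "q \<notin> I2" "I1 \<subseteq> {..<l}" "I2 \<subseteq> {..<l}" using q(2) I1(1) I2(1) J(1) by blast+
  have iso: "\<exists>g. part_iso G c t H d t' J (reach ?R w) (reach ?R' (h w)) g \<and> g w = h w" if "w \<in> P" for w
  proof (cases "w \<in> X1")
    case True
    show ?thesis
    proof (rule comp[OF True XV(1) I1 sp1 JY(1) F1 F'1])
      fix s s' assume s: "wl_equiv l G c H d s s'" "inj_on ((!) s) I1" "(!) s ` I1 = A1 \<union> B1"
        "flip_separates G s I1 X1 F1" "s ! q \<in> X1"
      show "\<exists>g. part_iso G c s H d s' I1 (reach (flip_adj G s I1 F1) (s ! q))
          (reach (flip_adj H s' I1 F1) (s' ! q)) g \<and> g (s ! q) = s' ! q"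
        by (rule Node.IH(1)[folded X1_def, OF dec(1) XV(1) rank(1) s(1) q'(3) s(2) q(1) q'(1) sp1 s(3) card(1,2) s(4,5)])
    qed
  next
    case False
    then have w: "w \<in> X2" using that PX X(1) by blast
    show ?thesis
    proof (rule comp[OF w XV(2) I2 sp2 JY(2) F2 F'2])
      fix s s' assume s: "wl_equiv l G c H d s s'" "inj_on ((!) s) I2" "(!) s ` I2 = A2 \<union> B2"
        "flip_separates G s I2 X2 F2" "s ! q \<in> X2"
      show "\<exists>g. part_iso G c s H d s' I2 (reach (flip_adj G s I2 F2) (s ! q))
          (reach (flip_adj H s' I2 F2) (s' ! q)) g \<and> g (s ! q) = s' ! q"
        by (rule Node.IH(2)[folded X2_def, OF dec(2) XV(2) rank(2) s(1) q'(4) s(2) q(1) q'(2) sp2 s(3) card(3,4) s(4,5)])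
    qed
  qed
  have closedP: "y \<in> P" if "x \<in> P" "?U x y" for x y
    using that reach_step[of x ?U "t ! p" y] by (simp add: P_def)
  have closedP': "y \<in> P'" if "x \<in> P'" "?U' x y" for x y
    using that reach_step[of x ?U' "t' ! p" y] by (simp add: P'_def)
  have finP: "finite P" using PV fin(1) finite_subset by auto
  have "\<exists>g. part_iso G c t H d t' J P P' g \<and> (t ! p \<in> P \<longrightarrow> g (t ! p) = h (t ! p))"
  proof (rule glue_components[OF sym F'_sym finP PV _ P'V _ h_bij iso])
    show "y \<in> P" if "x \<in> P" "?R x y" for x y using closedP[of x y] that by simp
    show "y \<in> P'" if "x \<in> P'" "?R' x y" for x y using closedP'[of x y] that by simp
  qed
  then obtain g where g: "part_iso G c t H d t' J P P' g" and ga': "t ! p \<in> P \<longrightarrow> g (t ! p) = h (t ! p)"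
    by (elim exE conjE) (rule that)
  have tpP: "t ! p \<in> P" unfolding P_def by (rule reach_self)
  \<comment> \<open>Writing \<open>t ! p\<close> at \<open>q\<close> creates two equal entries, and
    equivalent tuples have the same equalities.\<close>
  have "h (t ! p) = t' ! p"
    using wl_equiv_nth2(1)[OF h(2) q(1) p(1), of "t ! p"] PV tpP q len by auto
  then have ga: "g (t ! p) = t' ! p" using ga' tpP by simp
  \<comment> \<open>Return to the parent: fine types determine the coarse ones, so \<open>g\<close>
    respects the parent's flip on \<open>P\<close> and restricts to the component of the marked
    vertex.\<close>
  have typeI: "vertex_type H t' I (g x) = vertex_type G t I x" if "x \<in> P" for x
    unfolding vertex_type_restrict[OF J(2)] part_isoD(3)[OF g that] ..
  have gP: "g x \<in> P'" if "x \<in> P" for x using bij_betwE[OF part_isoD(1)[OF g]] that by simp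
  have eqS: "?S x y \<longleftrightarrow> ?S' (g x) (g y)" if "x \<in> P" "y \<in> P" for x y
    using part_isoD(4)[OF g that] typeI that gP PV P'V by (auto simp: flip_adj_def subset_iff)
  have closedS: "y \<in> P" if "x \<in> P" "?S x y" for x y using closedP that by simp
  have closedS': "y \<in> P'" if "x \<in> P'" "?S' x y" for x y using closedP' that by simp
  have reach1: "reach ?S (t ! p) \<subseteq> P"
    by (rule reach_subset[OF tpP closedS])
  have reach2: "bij_betw g (reach ?S (t ! p)) (reach ?S' (g (t ! p)))"
    by (rule reach_bij[OF part_isoD(1)[OF g] tpP]) (rule closedS closedS' eqS; assumption)+
  have "part_iso G c t H d t' I (reach ?S (t ! p)) (reach ?S' (t' ! p)) g"
    unfolding part_iso_def
  proof (intro conjI ballI)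
    show "bij_betw g (reach ?S (t ! p)) (reach ?S' (t' ! p))" using reach2 ga by simp
    fix x assume "x \<in> reach ?S (t ! p)"
    then have x: "x \<in> P" using reach1 by blast
    show "d (g x) = c x" by (rule part_isoD(2)[OF g x])
    show "vertex_type H t' I (g x) = vertex_type G t I x" by (rule typeI[OF x])
    fix y assume "y \<in> reach ?S (t ! p)"
    then have y: "y \<in> P" using reach1 by blast
    show "(x, y) \<in> parcs G \<longleftrightarrow> (g x, g y) \<in> parcs H" by (rule part_isoD(4)[OF g x y])
  qed
  then show ?case
    unfolding flip_adj_cong[OF agree_u(1)] flip_adj_cong[OF agree_u(2)] part_iso_cong[OF agree_u] tp[symmetric]
    using ga by (intro exI[of _ g] conjI)
qed

section \<open>The theorem\<close>

lemma exists_decomposing_tree: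
  assumes "finite X" "X \<noteq> {}"
  shows "\<exists>T. root_label T = X \<and> decomposes T"
  using assms
proof (induction X rule: finite_ne_induct)
  case (singleton x)
  show ?case by (intro exI[of _ "Leaf {x}"]) simp
next
  case (insert x X)
  then obtain T where "root_label T = X" "decomposes T" by blast
  then show ?case using insert.hyps(3)
    by (intro exI[of _ "Node (insert x X) (Leaf {x}) T"]) simp
qed

lemma rank_width_le_decomposition:
  assumes "finite (pverts G)" "pverts G \<noteq> {}" "rank_width G \<le> k"
  obtains T where "root_label T = pverts G" "decomposes T" "\<forall>Z\<in>labels T. cut_rank G Z \<le> k"
proof -
  \<comment> \<open>Nonemptiness ensures that the infimum is attained and is not the default value
    of \<open>Inf {}\<close>.\<close>
  have "decomposition_width G ` {T. rank_decomposition G T} \<noteq> {}"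
    using exists_decomposing_tree[OF assms(1,2)] by (simp add: rank_decomposition_def)
  then have "rank_width G \<in> decomposition_width G ` {T. rank_decomposition G T}"
    unfolding rank_width_def by (rule Inf_nat_def1)
  then obtain T where T: "rank_decomposition G T" "decomposition_width G T \<le> k"
    using assms(3) by auto
  have "finite (labels T)" by (induction T) auto
  then have "\<forall>Z\<in>labels T. cut_rank G Z \<le> k"
    using T(2) unfolding decomposition_width_def by (meson Max_ge finite_imageI imageI order_trans)
  then show ?thesis using that[of T] T(1) unfolding rank_decomposition_def by blast
qed

theorem theorem1p1:
  fixes k :: nat and G :: "'a pair_pre_digraph" and c :: "'a \<Rightarrow> 'c"
  assumes "k \<ge> 1"
    and "pair_graph G"
    and "rank_width G \<le> k"
  shows "wl_identifies TYPE('b) (3 * k + 4) G c"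
  unfolding wl_identifies_def
proof (intro allI impI)
  fix H :: "'b pair_pre_digraph" and d
  assume H: "pair_graph H" and niso: "\<not> coloured_isomorphic G c H d"
  let ?l = "3 * k + 4"
  have sym: "sym (parcs G)" "sym (parcs H)"
    using pair_graph_sym[OF assms(2)] pair_graph_sym[OF H] by (blast intro: symI)+
  have fin: "finite (pverts G)" "finite (pverts H)"
    using pair_graph_finite assms(2) H by blast+
  show "wl_distinguishes ?l G c H d"
  proof (rule ccontr)
    assume ndist: "\<not> wl_distinguishes ?l G c H d"
    have "coloured_isomorphic G c H d"
    proof (cases "pverts G = {}")
      case True
      \<comment> \<open>There is no decomposition to induct on; a constant tuple of positive length
        in a nonempty \<open>H\<close> would need a partner in \<open>G\<close>.\<close>
      have "pverts H = {}"
      proof (rule ccontr)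
        assume "pverts H \<noteq> {}"
        then obtain x where "x \<in> pverts H" by blast
        then have "set (replicate ?l x) \<subseteq> pverts H" by simp
        moreover have "\<not> wl_distinguishes ?l H d G c" using ndist unfolding wl_distinguishes_def by metis
        ultimately obtain w where "wl_equiv ?l H d G c (replicate ?l x) w"
          using wl_equiv_of_not_distinguished[OF fin(1), of ?l H d c "replicate ?l x"] fin(2) by auto
        then show False using True by (auto simp: wl_equiv_def)
      qed
      then show ?thesis using True by (simp add: coloured_isomorphic_def bij_betw_def)
    next
      case False
      then obtain x where x: "x \<in> pverts G" by blast
      obtain T where T: "root_label T = pverts G" "decomposes T" "\<forall>Z\<in>labels T. cut_rank G Z \<le> k"
        by (rule rank_width_le_decomposition[OF fin(1) False assms(3)])
      \<comment> \<open>The entries are placeholders: no position is occupied at the root, where the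
        split pair is empty.\<close>
      define u where "u = replicate ?l x"
      have u: "length u = ?l" "set u \<subseteq> pverts G" using x by (auto simp: u_def)
      obtain u' where uu: "wl_equiv ?l G c H d u u'"
        by (rule wl_equiv_of_not_distinguished[OF fin(2) ndist u fin(1)])
      have l0: "0 < ?l" by simp
      obtain h where h: "bij_betw h (pverts G) (pverts H)"
        "\<And>w. w \<in> pverts G \<Longrightarrow> wl_equiv ?l G c H d (u[0 := w]) (u'[0 := h w])"
        using wl_equiv_bij[OF fin uu] l0 by metis
      have len: "length u = ?l" "length u' = ?l" using uu by (simp_all add: wl_equiv_def)
      \<comment> \<open>At the root no edge crosses the cut, so nothing is flipped and the
        components are those of the graph itself.\<close>
      let ?F = "\<lambda>_ _. False"
      have iso: "\<exists>g. part_iso G c u H d u' {} (reach (flip_adj G u {} ?F) w)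
        (reach (flip_adj H u' {} ?F) (h w)) g \<and> g w = h w" if w: "w \<in> pverts G" for w
      proof -
        let ?s = "u[0 := w]" and ?s' = "u'[0 := h w]"
        have s0: "?s ! 0 = w" "?s' ! 0 = h w" using len by simp_all
        have "\<exists>g. part_iso G c ?s H d ?s' {} (reach (flip_adj G ?s {} ?F) (?s ! 0))
          (reach (flip_adj H ?s' {} ?F) (?s' ! 0)) g \<and> g (?s ! 0) = ?s' ! 0"
          by (rule component_iso[OF sym fin order_refl T(2) _ T(3) h(2)[OF w] _ _ l0 _
                split_pair_vertices[of G, folded T(1)]])
            (use w s0 T(1) in \<open>simp_all add: flip_separates_def\<close>)
        then show ?thesis
          unfolding s0 using flip_adj_cong[of "{}" ?s u G ?F] flip_adj_cong[of "{}" ?s' u' H ?F]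
            part_iso_cong[of "{}" ?s u ?s' u' G c H d] by simp
      qed
      have "\<exists>g. part_iso G c u H d u' {} (pverts G) (pverts H) g \<and> (x \<in> pverts G \<longrightarrow> g x = h x)"
        by (rule glue_components[OF sym _ fin(1) order_refl _ order_refl _ h(1) iso])
          (simp_all add: flip_adj_def)
      then obtain g where "part_iso G c u H d u' {} (pverts G) (pverts H) g"
        by (elim exE conjE) (rule that)
      then show ?thesis unfolding coloured_isomorphic_def part_iso_def by blast
    qed
    then show False using niso by simp
  qed
qed

end
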